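(* The functor $$\mathrm{Set}^{\mathcal{M}}_{\mathrm{tame}}\to\mathrm{Com}(\mathrm{Set}^M_{\mathrm{tame}},\boxtimes),\qquad X\mapsto (X,+),$$ is an isomorphism of categories from the category of tame $\mathcal{M}$-sets to the category of commutative monoids in the symmetric monoidal category $(\mathrm{Set}^M_{\mathrm{tame}},\boxtimes)$.
   Context: Let $\omega=\{1,2,3,\dots\}$, $\mathbf{n}=\{1,\dots,n\}$, and let $M$ be the monoid of injective maps $\omega\to\omega$ under composition. An $M$-set is a set with a left $M$-action; an element $x$ is supported on $A\subseteq\omega$ if $fx=x$ for every $f\in M$ fixing $A$ elementwise; $\mathrm{supp}(x)$ is the intersection of all finite subsets on which $x$ is supported ($\omega$ if there are none); an $M$-set is tame if every element is supported on some finite subset. $\mathrm{Set}^M_{\mathrm{tame}}$ is the category of tame $M$-sets, with symmetric monoidal product $X\boxtimes Y=\{(x,y)\in X\times Y:\mathrm{supp}(x)\cap\mathrm{supp}(y)=\emptyset\}$ (diagonal $M$-action), structure isomorphisms inherited from the cartesian product, and unit the one-element $M$-set. The injection operad $\mathcal{M}$ is the operad of sets with $M(n)$ the set of injective maps $\mathbf{n}\times\omega\to\omega$, right $\Sigma_n$-action $(\varphi\sigma)(k,i)=\varphi(\sigma(k),i)$, and structure maps $M(k)\times M(n_1)\times\dots\times M(n_k)\to M(n_1+\dots+n_k)$, $(\varphi;\psi_1,\dots,\psi_k)\mapsto\varphi\circ(\psi_1+\dots+\psi_k)$, where $(\varphi\circ(\psi_1+\dots+\psi_k))(i,j)=\varphi(m,\psi_m(i-(n_1+\dots+n_{m-1}),j))$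 with $m$ the unique number with $n_1+\dots+n_{m-1}<i\le n_1+\dots+n_m$. An $\mathcal{M}$-set is an algebra over $\mathcal{M}$, with action written $M(n)\times X^n\to X$, $(\varphi,x_1,\dots,x_n)\mapsto\varphi_*(x_1,\dots,x_n)$; morphisms of $\mathcal{M}$-sets are morphisms of algebras. Since $M(1)=M$, an $\mathcal{M}$-set has an underlying $M$-set; it is tame if the underlying $M$-set is. $\mathrm{Set}^{\mathcal{M}}_{\mathrm{tame}}$ is the category of tame $\mathcal{M}$-sets. The distinguished element $0$ of an $\mathcal{M}$-set $X$ is the image of the unique element of $M(0)$. For a tame $\mathcal{M}$-set $X$, the sum $+\colon X\boxtimes X\to X$ is defined by $x+y=\varphi_*(x,y)$ for any injection $\varphi\in M(2)$ with $\varphi(1,j)=j$ for all $j\in\mathrm{supp}(x)$ and $\varphi(2,j)=j$ for all $j\in\mathrm{supp}(y)$ (this is independent of the choice of $\varphi$). The functor sends $X$ to its underlying $M$-set with multiplication $+$ and unit $0$, and is the identity on underlying maps. *)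

theory Defs
  imports Main "HOL-Library.FuncSet" "HOL-Combinatorics.Permutations"
begin

section \<open>Categories, functors, isomorphisms of categories\<close>

text \<open>
  Morphisms are not required to determine their source and target, so composition, and the
  action of a functor on morphisms, take the relevant objects as arguments.
\<close>

record ('o, 'm) cat =
  Ob :: "'o set"
  Hom :: "'o \<Rightarrow> 'o \<Rightarrow> 'm set"
  Ident :: "'o \<Rightarrow> 'm"
  Cmp :: "'o \<Rightarrow> 'o \<Rightarrow> 'o \<Rightarrow> 'm \<Rightarrow> 'm \<Rightarrow> 'm"

definition is_category :: "('o, 'm) cat \<Rightarrow> bool" where
  "is_category C \<longleftrightarrow>
     (\<forall>X\<in>Ob C. Ident C X \<in> Hom C X X) \<and>
     (\<forall>X\<in>Ob C. \<forall>Y\<in>Ob C. \<forall>Z\<in>Ob C. \<forall>f\<in>Hom C X Y. \<forall>g\<in>Hom C Y Z.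
        Cmp C X Y Z g f \<in> Hom C X Z) \<and>
     (\<forall>X\<in>Ob C. \<forall>Y\<in>Ob C. \<forall>f\<in>Hom C X Y.
        Cmp C X X Y f (Ident C X) = f \<and> Cmp C X Y Y (Ident C Y) f = f) \<and>
     (\<forall>W\<in>Ob C. \<forall>X\<in>Ob C. \<forall>Y\<in>Ob C. \<forall>Z\<in>Ob C.
        \<forall>f\<in>Hom C W X. \<forall>g\<in>Hom C X Y. \<forall>h\<in>Hom C Y Z.
        Cmp C W Y Z h (Cmp C W X Y g f) = Cmp C W X Z (Cmp C X Y Z h g) f)"

record ('o, 'm, 'p, 'n) funct =
  fobj :: "'o \<Rightarrow> 'p"
  fmor :: "'o \<Rightarrow> 'o \<Rightarrow> 'm \<Rightarrow> 'n"

definition is_functor ::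
    "('o, 'm) cat \<Rightarrow> ('p, 'n) cat \<Rightarrow> ('o, 'm, 'p, 'n) funct \<Rightarrow> bool" where
  "is_functor C D F \<longleftrightarrow>
     (\<forall>X\<in>Ob C. fobj F X \<in> Ob D) \<and>
     (\<forall>X\<in>Ob C. \<forall>Y\<in>Ob C. \<forall>f\<in>Hom C X Y. fmor F X Y f \<in> Hom D (fobj F X) (fobj F Y)) \<and>
     (\<forall>X\<in>Ob C. fmor F X X (Ident C X) = Ident D (fobj F X)) \<and>
     (\<forall>X\<in>Ob C. \<forall>Y\<in>Ob C. \<forall>Z\<in>Ob C. \<forall>f\<in>Hom C X Y. \<forall>g\<in>Hom C Y Z.
        fmor F X Z (Cmp C X Y Z g f) =
        Cmp D (fobj F X) (fobj F Y) (fobj F Z) (fmor F Y Z g) (fmor F X Y f))"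

definition inverse_functor ::
    "('o, 'm) cat \<Rightarrow> ('o, 'm, 'p, 'n) funct \<Rightarrow> ('p, 'n, 'o, 'm) funct \<Rightarrow> bool" where
  "inverse_functor C F G \<longleftrightarrow>
     (\<forall>X\<in>Ob C. fobj G (fobj F X) = X) \<and>
     (\<forall>X\<in>Ob C. \<forall>Y\<in>Ob C. \<forall>f\<in>Hom C X Y. fmor G (fobj F X) (fobj F Y) (fmor F X Y f) = f)"

definition is_category_isomorphism ::
    "('o, 'm) cat \<Rightarrow> ('p, 'n) cat \<Rightarrow> ('o, 'm, 'p, 'n) funct \<Rightarrow> bool" where
  "is_category_isomorphism C D F \<longleftrightarrow>
     is_category C \<and> is_category D \<and> is_functor C D F \<and>
     (\<exists>G. is_functor D C G \<and> inverse_functor C F G \<and> inverse_functor D G F)"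


section \<open>The injection monoid and tame \<open>M\<close>-sets\<close>

typedef omega = "{n::nat. 1 \<le> n}"
  by auto

definition inj_monoid :: "(omega \<Rightarrow> omega) set" where
  "inj_monoid = {f. inj f}"

text \<open>
  All structure maps are extensional (\<open>undefined\<close> off their domain), so that two structures are
  equal as records exactly when they are equal as mathematical objects.
\<close>

record 'a M_set =
  mcarrier :: "'a set"
  mact :: "(omega \<Rightarrow> omega) \<Rightarrow> 'a \<Rightarrow> 'a"

definition is_M_set :: "'a M_set \<Rightarrow> bool" where
  "is_M_set X \<longleftrightarrow>
     mact X \<in> inj_monoid \<rightarrow>\<^sub>E (mcarrier X \<rightarrow>\<^sub>E mcarrier X) \<and>
     (\<forall>x\<in>mcarrier X. mact X id x = x) \<and>
     (\<forall>f\<in>inj_monoid. \<forall>g\<in>inj_monoid. \<forall>x\<in>mcarrier X.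
        mact X (f \<circ> g) x = mact X f (mact X g x))"

definition supported_on :: "'a M_set \<Rightarrow> 'a \<Rightarrow> omega set \<Rightarrow> bool" where
  "supported_on X x A \<longleftrightarrow> (\<forall>f\<in>inj_monoid. (\<forall>a\<in>A. f a = a) \<longrightarrow> mact X f x = x)"

text \<open>The intersection of the empty family is \<open>UNIV\<close>, i.e. all of \<open>\<omega>\<close>.\<close>

definition supp :: "'a M_set \<Rightarrow> 'a \<Rightarrow> omega set" where
  "supp X x = \<Inter>{A. finite A \<and> supported_on X x A}"

definition is_tame_M_set :: "'a M_set \<Rightarrow> bool" where
  "is_tame_M_set X \<longleftrightarrow>
     is_M_set X \<and> (\<forall>x\<in>mcarrier X. \<exists>A. finite A \<and> supported_on X x A)"

definition M_hom :: "'a M_set \<Rightarrow> 'b M_set \<Rightarrow> ('a \<Rightarrow> 'b) set" where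
  "M_hom X Y = {h \<in> mcarrier X \<rightarrow>\<^sub>E mcarrier Y.
     \<forall>f\<in>inj_monoid. \<forall>x\<in>mcarrier X. h (mact X f x) = mact Y f (h x)}"


section \<open>The box product and commutative monoids\<close>

definition box_carrier :: "'a M_set \<Rightarrow> 'b M_set \<Rightarrow> ('a \<times> 'b) set" where
  "box_carrier X Y = {(x, y). x \<in> mcarrier X \<and> y \<in> mcarrier Y \<and> supp X x \<inter> supp Y y = {}}"

definition box :: "'a M_set \<Rightarrow> 'b M_set \<Rightarrow> ('a \<times> 'b) M_set" (infixr \<open>\<boxtimes>\<close> 70) where
  "X \<boxtimes> Y = \<lparr>mcarrier = box_carrier X Y,
     mact = (\<lambda>f\<in>inj_monoid. \<lambda>p\<in>box_carrier X Y. map_prod (mact X f) (mact Y f) p)\<rparr>"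

definition unit_M_set :: "unit M_set" where
  "unit_M_set = \<lparr>mcarrier = UNIV, mact = (\<lambda>f\<in>inj_monoid. \<lambda>x. x)\<rparr>"

definition assoc_map :: "('a \<times> 'b) \<times> 'c \<Rightarrow> 'a \<times> ('b \<times> 'c)" where
  "assoc_map = (\<lambda>((x, y), z). (x, (y, z)))"

record 'a M_monoid =
  base :: "'a M_set"
  mult :: "'a \<times> 'a \<Rightarrow> 'a"
  neut :: "unit \<Rightarrow> 'a"

text \<open>
  The associativity, unit and symmetry diagrams, with \<open>assoc_map\<close>, \<open>snd\<close>, \<open>fst\<close> and
  \<open>prod.swap\<close> as associativity, left unit, right unit and symmetry isomorphisms, and
  \<open>map_prod\<close> as the \<open>\<boxtimes>\<close>-product of morphisms.
\<close>

definition is_tame_com_monoid :: "'a M_monoid \<Rightarrow> bool" where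
  "is_tame_com_monoid R \<longleftrightarrow>
     (let X = base R; \<mu> = mult R; \<eta> = neut R in
       is_tame_M_set X \<and>
       \<mu> \<in> M_hom (X \<boxtimes> X) X \<and>
       \<eta> \<in> M_hom unit_M_set X \<and>
       (\<forall>p\<in>mcarrier ((X \<boxtimes> X) \<boxtimes> X).
          \<mu> (map_prod \<mu> id p) = \<mu> (map_prod id \<mu> (assoc_map p))) \<and>
       (\<forall>p\<in>mcarrier (unit_M_set \<boxtimes> X). \<mu> (map_prod \<eta> id p) = snd p) \<and>
       (\<forall>p\<in>mcarrier (X \<boxtimes> unit_M_set). \<mu> (map_prod id \<eta> p) = fst p) \<and>
       (\<forall>p\<in>mcarrier (X \<boxtimes> X). \<mu> (prod.swap p) = \<mu> p))"

definition com_monoid_hom :: "'a M_monoid \<Rightarrow> 'b M_monoid \<Rightarrow> ('a \<Rightarrow> 'b) set" where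
  "com_monoid_hom R S = {h \<in> M_hom (base R) (base S).
     (\<forall>p\<in>mcarrier (base R \<boxtimes> base R). h (mult R p) = mult S (map_prod h h p)) \<and>
     (\<forall>u\<in>mcarrier unit_M_set. h (neut R u) = neut S u)}"

definition com_monoid_cat :: "('a M_monoid, 'a \<Rightarrow> 'a) cat" where
  "com_monoid_cat = \<lparr>Ob = {R. is_tame_com_monoid R},
     Hom = com_monoid_hom,
     Ident = (\<lambda>R. \<lambda>x\<in>mcarrier (base R). x),
     Cmp = (\<lambda>R S T g f. compose (mcarrier (base R)) g f)\<rparr>"


section \<open>The injection operad and its algebras\<close>

definition inj_op :: "nat \<Rightarrow> (nat \<times> omega \<Rightarrow> omega) set" where
  "inj_op n = {\<phi> \<in> extensional ({1..n} \<times> UNIV). inj_on \<phi> ({1..n} \<times> UNIV)}"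

definition op_unit :: "nat \<times> omega \<Rightarrow> omega" where
  "op_unit = (\<lambda>(k, i)\<in>{1..1} \<times> UNIV. i)"

definition op_perm ::
    "nat \<Rightarrow> (nat \<times> omega \<Rightarrow> omega) \<Rightarrow> (nat \<Rightarrow> nat) \<Rightarrow> (nat \<times> omega \<Rightarrow> omega)" where
  "op_perm n \<phi> \<sigma> = (\<lambda>(k, i)\<in>{1..n} \<times> UNIV. \<phi> (\<sigma> k, i))"

text \<open>
  For a position \<open>i\<close> in a concatenation of \<open>k\<close> blocks of lengths \<open>ns 1, \<dots>, ns k\<close>, the number of
  the block containing \<open>i\<close> and the position of \<open>i\<close> inside that block.
\<close>

definition block :: "nat \<Rightarrow> (nat \<Rightarrow> nat) \<Rightarrow> nat \<Rightarrow> nat" where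
  "block k ns i = (THE m. m \<in> {1..k} \<and> sum ns {1..<m} < i \<and> i \<le> sum ns {1..m})"

definition block_pos :: "nat \<Rightarrow> (nat \<Rightarrow> nat) \<Rightarrow> nat \<Rightarrow> nat" where
  "block_pos k ns i = i - sum ns {1..<block k ns i}"

definition op_comp ::
    "nat \<Rightarrow> (nat \<Rightarrow> nat) \<Rightarrow> (nat \<times> omega \<Rightarrow> omega) \<Rightarrow> (nat \<Rightarrow> nat \<times> omega \<Rightarrow> omega)
      \<Rightarrow> (nat \<times> omega \<Rightarrow> omega)" where
  "op_comp k ns \<phi> \<psi> =
     (\<lambda>(i, j)\<in>{1..sum ns {1..k}} \<times> UNIV.
        \<phi> (block k ns i, \<psi> (block k ns i) (block_pos k ns i, j)))"

text \<open>The element \<open>(x 1, \<dots>, x k)\<close> of \<open>X\<^sup>n\<close>, \<open>n = ns 1 + \<dots> + ns k\<close>, for tuples \<open>x m\<close> of length \<open>ns m\<close>.\<close>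

definition tuple_concat :: "nat \<Rightarrow> (nat \<Rightarrow> nat) \<Rightarrow> (nat \<Rightarrow> nat \<Rightarrow> 'a) \<Rightarrow> (nat \<Rightarrow> 'a)" where
  "tuple_concat k ns x = (\<lambda>i\<in>{1..sum ns {1..k}}. x (block k ns i) (block_pos k ns i))"

text \<open>\<open>aact X n \<phi> x\<close> is \<open>\<phi>\<^sub>*(x 1, \<dots>, x n)\<close>.\<close>

record 'a op_set =
  acarrier :: "'a set"
  aact :: "nat \<Rightarrow> (nat \<times> omega \<Rightarrow> omega) \<Rightarrow> (nat \<Rightarrow> 'a) \<Rightarrow> 'a"

definition tuples :: "'a op_set \<Rightarrow> nat \<Rightarrow> (nat \<Rightarrow> 'a) set" where
  "tuples X n = ({1..n} \<rightarrow>\<^sub>E acarrier X)"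

definition is_op_set :: "'a op_set \<Rightarrow> bool" where
  "is_op_set X \<longleftrightarrow>
     (\<forall>n. aact X n \<in> inj_op n \<rightarrow>\<^sub>E (tuples X n \<rightarrow>\<^sub>E acarrier X)) \<and>
     (\<forall>x\<in>tuples X 1. aact X 1 op_unit x = x 1) \<and>
     (\<forall>k ns \<phi> \<psi> x.
        \<phi> \<in> inj_op k \<longrightarrow> (\<forall>m\<in>{1..k}. \<psi> m \<in> inj_op (ns m)) \<longrightarrow>
        (\<forall>m\<in>{1..k}. x m \<in> tuples X (ns m)) \<longrightarrow>
        aact X (sum ns {1..k}) (op_comp k ns \<phi> \<psi>) (tuple_concat k ns x) =
        aact X k \<phi> (\<lambda>m\<in>{1..k}. aact X (ns m) (\<psi> m) (x m))) \<and>
     (\<forall>n. \<forall>\<phi>\<in>inj_op n. \<forall>\<sigma>. \<sigma> permutes {1..n} \<longrightarrow> (\<forall>x\<in>tuples X n.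
        aact X n (op_perm n \<phi> \<sigma>) x = aact X n \<phi> (\<lambda>i\<in>{1..n}. x (inv \<sigma> i))))"

definition op_set_hom :: "'a op_set \<Rightarrow> 'b op_set \<Rightarrow> ('a \<Rightarrow> 'b) set" where
  "op_set_hom X Y = {h \<in> acarrier X \<rightarrow>\<^sub>E acarrier Y.
     \<forall>n. \<forall>\<phi>\<in>inj_op n. \<forall>x\<in>tuples X n. h (aact X n \<phi> x) = aact Y n \<phi> (\<lambda>i\<in>{1..n}. h (x i))}"

definition op_of_inj :: "(omega \<Rightarrow> omega) \<Rightarrow> (nat \<times> omega \<Rightarrow> omega)" where
  "op_of_inj f = (\<lambda>(k, i)\<in>{1..1} \<times> UNIV. f i)"

definition underlying :: "'a op_set \<Rightarrow> 'a M_set" where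
  "underlying X = \<lparr>mcarrier = acarrier X,
     mact = (\<lambda>f\<in>inj_monoid. \<lambda>x\<in>acarrier X. aact X 1 (op_of_inj f) (\<lambda>i\<in>{1..1}. x))\<rparr>"

definition is_tame_op_set :: "'a op_set \<Rightarrow> bool" where
  "is_tame_op_set X \<longleftrightarrow> is_op_set X \<and> is_tame_M_set (underlying X)"

definition tame_op_set_cat :: "('a op_set, 'a \<Rightarrow> 'a) cat" where
  "tame_op_set_cat = \<lparr>Ob = {X. is_tame_op_set X},
     Hom = op_set_hom,
     Ident = (\<lambda>X. \<lambda>x\<in>acarrier X. x),
     Cmp = (\<lambda>X Y Z g f. compose (acarrier X) g f)\<rparr>"


section \<open>The sum and the functor\<close>

text \<open>\<open>\<lambda>_. undefined\<close> is both the unique element of \<open>inj_op 0\<close> and the empty tuple.\<close>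

definition op_zero :: "'a op_set \<Rightarrow> 'a" where
  "op_zero X = aact X 0 (\<lambda>_. undefined) (\<lambda>_. undefined)"

definition pair_tuple :: "'a \<Rightarrow> 'a \<Rightarrow> (nat \<Rightarrow> 'a)" where
  "pair_tuple x y = (\<lambda>i\<in>{1..2}. if i = 1 then x else y)"

text \<open>
  The common value of \<open>\<phi>\<^sub>*(x, y)\<close> over all admissible \<open>\<phi>\<close>; meaningful because such \<open>\<phi>\<close> exist and
  the value does not depend on the choice.
\<close>

definition op_sum :: "'a op_set \<Rightarrow> 'a \<Rightarrow> 'a \<Rightarrow> 'a" where
  "op_sum X x y = (THE z. \<forall>\<phi>\<in>inj_op 2.
     (\<forall>j\<in>supp (underlying X) x. \<phi> (1, j) = j) \<longrightarrow>
     (\<forall>j\<in>supp (underlying X) y. \<phi> (2, j) = j) \<longrightarrow>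
     z = aact X 2 \<phi> (pair_tuple x y))"

definition sum_monoid :: "'a op_set \<Rightarrow> 'a M_monoid" where
  "sum_monoid X = \<lparr>base = underlying X,
     mult = (\<lambda>(x, y)\<in>mcarrier (underlying X \<boxtimes> underlying X). op_sum X x y),
     neut = (\<lambda>_. op_zero X)\<rparr>"

definition sum_functor :: "('a op_set, 'a \<Rightarrow> 'a, 'a M_monoid, 'a \<Rightarrow> 'a) funct" where
  "sum_functor = \<lparr>fobj = sum_monoid, fmor = (\<lambda>X Y h. h)\<rparr>"

end

(*
  The value of an operation phi on a tuple x of elements of a tame algebra depends only on the
  restriction of phi to the supports of the entries x_i.  Hence phi_*(x_1, ..., x_n) is the sum of
  the elements phi(i, -) x_i, whose supports are pairwise disjoint, so that the algebra structure
  is determined by the monoid structure.  Conversely, a commutative monoid (X, +) becomes an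
  algebra by this very formula: the operad axioms reduce to the associativity and commutativity of
  finite sums of elements with pairwise disjoint supports.
*)
theory Submission
  imports Defs "HOL-Library.Nat_Bijection"
begin

section \<open>Extending finite injections\<close>

text \<open>For a single injection, its values on a finite support decide how it acts, by a short
  factorisation through a bijection that extends its restriction to that support. For operations of
  arity at least two this argument breaks down. Even when \<open>\<phi>\<close> is a bijection,
  \<open>\<phi>'\<close> has the form \<open>\<phi> \<circ> u\<close> with an injection
  \<open>u\<close> of \<open>{1..n} \<times> \<omega>\<close> that may mix the slots, and the
  algebra axioms give no meaning to acting by such a \<open>u\<close>. What they allow is to insert
  injections into the separate slots and to apply an injection of \<omega> afterwards. Two
  operations that agree on the supports are therefore brought to a common normal form by changes of
  these two kinds. Tameness enters twice: the supports of the entries are finite, and so are the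
  supports of the two values being compared. The isomorphism is strict: the inverse on objects is an
  explicit formula, all structure maps are \<open>undefined\<close> off their domains, and both
  functors leave maps unchanged.\<close>

lemma mem_inj_monoid [simp]: "f \<in> inj_monoid \<longleftrightarrow> inj f"
  by (simp add: inj_monoid_def)

lemma inj_comp_lambda [simp]: "inj f \<Longrightarrow> inj g \<Longrightarrow> inj (\<lambda>j. f (g j))"
  using inj_compose [of f g] by (simp add: comp_def)

lemma infinite_UNIV_omega: "infinite (UNIV :: omega set)"
proof
  assume "finite (UNIV :: omega set)"
  then have "finite (range Rep_omega)" by (rule finite_imageI)
  moreover have "range Rep_omega = {1..}"
    using type_definition.Rep_range [OF type_definition_omega] by auto
  ultimately show False using infinite_Ici by auto
qed

lemma obtain_fresh_sequence:
  assumes "finite C"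
  obtains r :: "nat \<Rightarrow> omega" where "inj r" "\<And>i. r i \<notin> C"
proof -
  have "infinite (UNIV - C)" using assms infinite_UNIV_omega by simp
  then obtain r :: "nat \<Rightarrow> omega" where "inj r" "range r \<subseteq> UNIV - C"
    using infinite_countable_subset by blast
  then show thesis using that by blast
qed

text \<open>\<open>A\<close> and its image have equally many elements, hence so do their complements
  in the finite union of both; matching these complements closes \<open>f\<close> up to a
  permutation of the union, and the identity does the rest. A bijection is wanted because its
  inverse then lies in the injection monoid as well.\<close>

lemma finite_inj_extends_bij:
  fixes f :: "omega \<Rightarrow> omega"
  assumes "finite A" "inj_on f A"
  obtains g where "bij g" "\<And>a. a \<in> A \<Longrightarrow> g a = f a"
proof -
  let ?U = "A \<union> f ` A"
  have fin: "finite ?U" using assms by simp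
  have "card (?U - A) = card (?U - f ` A)"
    using assms(1) by (simp add: card_Diff_subset card_image [OF assms(2)])
  then obtain h where h: "bij_betw h (?U - A) (?U - f ` A)"
    using finite_same_card_bij [of "?U - A" "?U - f ` A"] fin by auto
  let ?g = "\<lambda>a. if a \<in> A then f a else if a \<in> ?U then h a else a"
  have "bij_betw ?g A (f ` A)"
    using assms by (simp add: bij_betw_def cong: inj_on_cong)
  moreover have "bij_betw ?g (?U - A) (?U - f ` A)"
    using h by (rule bij_betw_cong [THEN iffD1, rotated]) auto
  moreover have "bij_betw ?g (- ?U) (- ?U)"
    by (rule bij_betw_cong [THEN iffD1, OF _ bij_betw_id]) auto
  ultimately have "bij_betw ?g ((A \<union> (?U - A)) \<union> - ?U) ((f ` A \<union> (?U - f ` A)) \<union> - ?U)"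
    by (intro bij_betw_combine) blast+
  moreover have "(A \<union> (?U - A)) \<union> - ?U = UNIV" "(f ` A \<union> (?U - f ` A)) \<union> - ?U = UNIV" by auto
  ultimately have "bij ?g" by simp
  then show thesis using that by simp
qed

text \<open>Arguments outside \<open>S\<close> are numbered by the pairing function and sent along a
  sequence that avoids the values of \<open>f\<close> on \<open>S\<close>, so no new collision
  arises.\<close>

lemma finite_inj_extends_op:
  fixes f :: "nat \<times> omega \<Rightarrow> omega"
  assumes "finite S" "S \<subseteq> {1..n} \<times> UNIV" "inj_on f S"
  obtains \<phi> where "\<phi> \<in> inj_op n" "\<And>p. p \<in> S \<Longrightarrow> \<phi> p = f p"
proof -
  obtain r :: "nat \<Rightarrow> omega" where r: "inj r" "\<And>i. r i \<notin> f ` S"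
    using obtain_fresh_sequence [of "f ` S"] assms(1) by blast
  let ?c = "\<lambda>p. r (prod_encode (fst p, Rep_omega (snd p)))"
  let ?\<phi> = "restrict (\<lambda>p. if p \<in> S then f p else ?c p) ({1..n} \<times> UNIV)"
  have "?c p = ?c q \<longleftrightarrow> p = q" for p q
    using r(1) by (auto simp: inj_eq prod_encode_eq Rep_omega_inject prod_eq_iff)
  moreover have "?c p \<noteq> f q" if "q \<in> S" for p q using r(2) that by (metis imageI)
  ultimately have "inj_on ?\<phi> ({1..n} \<times> UNIV)"
    using assms(3) unfolding inj_on_def
    by (smt (verit, best) restrict_apply)
  then have "?\<phi> \<in> inj_op n" by (simp add: inj_op_def)
  moreover have "?\<phi> p = f p" if "p \<in> S" for p using assms(2) that by auto
  ultimately show thesis using that by blast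
qed

text \<open>For pairwise disjoint sets the second projection is injective on their disjoint union,
  so it is a finite partial operation that can be extended. This supplies the admissible operations
  in the definition of the sum.\<close>

lemma obtain_fixing_op:
  fixes A :: "nat \<Rightarrow> omega set"
  assumes "\<And>i. i \<in> {1..n} \<Longrightarrow> finite (A i)"
    and "\<And>i j. i \<in> {1..n} \<Longrightarrow> j \<in> {1..n} \<Longrightarrow> i \<noteq> j \<Longrightarrow> A i \<inter> A j = {}"
  obtains \<phi> where "\<phi> \<in> inj_op n" "\<And>i j. i \<in> {1..n} \<Longrightarrow> j \<in> A i \<Longrightarrow> \<phi> (i, j) = j"
proof -
  have "inj_on snd (Sigma {1..n} A)"
    using assms(2) unfolding inj_on_def by (metis IntI SigmaE2 empty_iff prod.collapse)
  moreover have "finite (Sigma {1..n} A)" using assms(1) by (intro finite_SigmaI) auto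
  ultimately obtain \<phi> where "\<phi> \<in> inj_op n" "\<And>p. p \<in> Sigma {1..n} A \<Longrightarrow> \<phi> p = snd p"
    using finite_inj_extends_op [of "Sigma {1..n} A" n snd] by blast
  then show thesis using that by simp
qed

text \<open>Frees everything outside \<open>A\<close> from a finite set of unwanted points, while
  elements supported on \<open>A\<close> are not affected. The fixed points lie in \<open>D\<close>
  and the moved ones land outside it, so they cannot collide.\<close>

lemma obtain_avoiding_inj:
  fixes A D :: "omega set"
  assumes "finite D" "A \<subseteq> D"
  obtains f where "inj f" "\<And>a. a \<in> A \<Longrightarrow> f a = a" "\<And>a. a \<notin> A \<Longrightarrow> f a \<notin> D"
proof -
  obtain r :: "nat \<Rightarrow> omega" where r: "inj r" "\<And>i. r i \<notin> D" using obtain_fresh_sequence assms(1) by blast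
  let ?f = "\<lambda>a. if a \<in> A then a else r (Rep_omega a)"
  have "r i \<notin> A" for i using r(2) assms(2) by blast
  then have "inj ?f" using r(1) unfolding inj_def by (metis Rep_omega_inject)
  then show thesis using that [of ?f] r by simp
qed


section \<open>Supports in tame \<open>M\<close>-sets\<close>

locale tame_M_set =
  fixes X :: "'a M_set"
  assumes tame: "is_tame_M_set X"
begin

lemma act_closed [simp]: "inj f \<Longrightarrow> x \<in> mcarrier X \<Longrightarrow> mact X f x \<in> mcarrier X"
  using tame unfolding is_tame_M_set_def is_M_set_def by (simp add: PiE_iff)

lemma act_id [simp]: "x \<in> mcarrier X \<Longrightarrow> mact X id x = x"
  using tame unfolding is_tame_M_set_def is_M_set_def by blast

lemma act_comp:
  "inj f \<Longrightarrow> inj g \<Longrightarrow> x \<in> mcarrier X \<Longrightarrow> mact X f (mact X g x) = mact X (\<lambda>j. f (g j)) x"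
  using tame by (simp add: is_tame_M_set_def is_M_set_def comp_def)

text \<open>In general \<open>f\<close> is not of the form \<open>g \<circ> u\<close>, since the
  image of \<open>f\<close> need not lie in that of \<open>g\<close>. Both are therefore compared
  with a bijection extending their common restriction to \<open>A\<close>.\<close>

lemma act_cong_supported:
  assumes x: "x \<in> mcarrier X" and A: "finite A" "supported_on X x A"
    and f: "inj f" and g: "inj g" and fg: "\<And>a. a \<in> A \<Longrightarrow> f a = g a"
  shows "mact X f x = mact X g x"
proof -
  obtain h where h: "bij h" "\<And>a. a \<in> A \<Longrightarrow> h a = f a"
    using finite_inj_extends_bij [of A f] A(1) f by (metis inj_on_subset subset_UNIV)
  \<comment> \<open>Every injection \<open>k\<close> that agrees with the bijection \<open>h\<close> on \<open>A\<close> differs from it by \<open>inv h \<circ> k\<close>, which fixes \<open>A\<close>.\<close>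
  have "mact X k x = mact X h x" if k: "inj k" "\<And>a. a \<in> A \<Longrightarrow> k a = h a" for k
  proof -
    let ?u = "\<lambda>a. inv h (k a)"
    have u: "inj ?u" using k(1) h(1) bij_betw_inv_into bij_is_inj by (fastforce simp: inj_def)
    have "?u a = a" if "a \<in> A" for a using h k that by (metis bij_inv_eq_iff)
    then have "mact X ?u x = x" using A u by (simp add: supported_on_def)
    then have "mact X h x = mact X (\<lambda>j. h (?u j)) x"
      using act_comp [OF _ u x, of h] h(1) by (simp add: bij_is_inj)
    then show ?thesis using h(1) by (simp add: bij_is_surj surj_f_inv_f)
  qed
  from this [OF f] this [OF g] show ?thesis using fg h by metis
qed

text \<open>If \<open>g\<close> fixes the image of \<open>A\<close> under \<open>f\<close>, then
  \<open>g \<circ> f\<close> and \<open>f\<close> agree on \<open>A\<close> and hence act alike on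
  \<open>x\<close>.\<close>

lemma supported_on_act:
  assumes "x \<in> mcarrier X" "finite A" "supported_on X x A" "inj f"
  shows "supported_on X (mact X f x) (f ` A)"
  unfolding supported_on_def
proof (intro ballI impI)
  fix g assume g: "g \<in> inj_monoid" "\<forall>a\<in>f ` A. g a = a"
  have "inj (\<lambda>j. g (f j))" using g assms(4) by simp
  then show "mact X g (mact X f x) = mact X f x"
    using g assms act_cong_supported [of x A "\<lambda>j. g (f j)" f] by (simp add: act_comp)
qed

text \<open>An injection \<open>f\<close> that fixes just \<open>A \<inter> B\<close> is traded for
  a bijection \<open>g\<close> that equals \<open>f\<close> on \<open>A\<close> and fixes a
  displaced copy of \<open>B\<close>. The first property makes \<open>g\<close> act on
  \<open>x\<close> like \<open>f\<close>, the second makes it act trivially. The displacement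
  \<open>p\<close> fixes \<open>A\<close>, so it leaves \<open>x\<close> alone, and the displaced
  copy still supports \<open>x\<close> but meets \<open>A\<close> only inside
  \<open>A \<inter> B\<close>.\<close>

lemma supported_on_Int:
  assumes x: "x \<in> mcarrier X" and A: "finite A" "supported_on X x A"
    and B: "finite B" "supported_on X x B"
  shows "supported_on X x (A \<inter> B)"
  unfolding supported_on_def
proof (intro ballI impI)
  fix f assume "f \<in> inj_monoid" and fix_f: "\<forall>a\<in>A \<inter> B. f a = a"
  then have f: "inj f" by simp
  \<comment> \<open>Move \<open>B - A\<close> away from \<open>A\<close> and \<open>f ` A\<close>, keeping \<open>A\<close> fixed.\<close>
  obtain p where p: "inj p" "\<And>a. a \<in> A \<Longrightarrow> p a = a" "\<And>a. a \<notin> A \<Longrightarrow> p a \<notin> A \<union> f ` A"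
    using obtain_avoiding_inj [of "A \<union> f ` A" A] A(1) by auto
  have px: "mact X p x = x" using A p by (simp add: supported_on_def)
  have supp_pB: "supported_on X x (p ` B)" using supported_on_act [OF x B p(1)] px by simp
  let ?g = "\<lambda>a. if a \<in> A then f a else a"
  \<comment> \<open>The points of the displaced copy outside \<open>A\<close> also avoid the values
    of \<open>f\<close> on \<open>A\<close>, by the choice of \<open>p\<close>; so the two halves of
    \<open>?g\<close> have disjoint images.\<close>
  have "inj_on ?g (A \<union> p ` B)"
    unfolding inj_on_def using f p fix_f by (auto simp: inj_eq) (metis IntI imageI UnCI)+
  then obtain g where g: "bij g" "\<And>a. a \<in> A \<union> p ` B \<Longrightarrow> g a = ?g a"
    using finite_inj_extends_bij [of "A \<union> p ` B" ?g] A(1) B(1) by blast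
  have ig: "inj g" using g(1) bij_is_inj by blast
  have "b \<in> A \<inter> B" if "b \<in> p ` B" "b \<in> A" for b using that p by (metis Int_iff UnCI imageE)
  then have "g b = b" if "b \<in> p ` B" for b using that g(2) [of b] fix_f by auto
  then have "mact X g x = x" using supp_pB ig by (simp add: supported_on_def)
  moreover have "mact X f x = mact X g x" using act_cong_supported [OF x A f ig] g by simp
  ultimately show "mact X f x = x" by simp
qed

text \<open>A supporting set \<open>A\<close> of least cardinality is contained in every other one,
  since \<open>A \<inter> B\<close> supports \<open>x\<close> too and cannot be smaller. The
  intersection that defines \<open>supp\<close> is therefore attained.\<close>

lemma finite_supported_supp:
  assumes x: "x \<in> mcarrier X"
  shows "finite (supp X x) \<and> supported_on X x (supp X x)"
proof -
  let ?P = "\<lambda>A. finite A \<and> supported_on X x A"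
  obtain A0 where "?P A0" using tame x unfolding is_tame_M_set_def by blast
  then obtain A where A: "?P A" "\<And>B. ?P B \<Longrightarrow> card A \<le> card B"
    using ex_has_least_nat [of ?P A0 card] by blast
  have "A \<subseteq> B" if "?P B" for B
  proof -
    have "card A \<le> card (A \<inter> B)" using A that supported_on_Int [OF x] by simp
    then show ?thesis using A(1) by (metis Int_lower1 card_seteq inf.absorb_iff1)
  qed
  then have "supp X x = A" using A(1) unfolding supp_def by blast
  then show ?thesis using A(1) by simp
qed

lemma finite_supp [simp]: "x \<in> mcarrier X \<Longrightarrow> finite (supp X x)"
  and supported_on_supp: "x \<in> mcarrier X \<Longrightarrow> supported_on X x (supp X x)"
  using finite_supported_supp by auto

lemma supp_subset: "finite A \<Longrightarrow> supported_on X x A \<Longrightarrow> supp X x \<subseteq> A"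
  by (auto simp: supp_def)

lemma act_fix: "x \<in> mcarrier X \<Longrightarrow> inj f \<Longrightarrow> (\<And>a. a \<in> supp X x \<Longrightarrow> f a = a) \<Longrightarrow> mact X f x = x"
  using supported_on_supp by (simp add: supported_on_def)

lemma supp_act_subset: "x \<in> mcarrier X \<Longrightarrow> inj f \<Longrightarrow> supp X (mact X f x) \<subseteq> f ` supp X x"
  by (simp add: supp_subset supported_on_act supported_on_supp)

end

lemma supp_hom_subset:
  assumes "is_tame_M_set X" "is_tame_M_set Y" "h \<in> M_hom X Y" "x \<in> mcarrier X"
  shows "supp Y (h x) \<subseteq> supp X x"
proof -
  interpret X: tame_M_set X by unfold_locales fact
  interpret Y: tame_M_set Y by unfold_locales fact
  have "supported_on Y (h x) (supp X x)"
    using X.supported_on_supp assms unfolding supported_on_def M_hom_def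
    by (smt (verit) mem_Collect_eq)
  then show ?thesis using assms by (simp add: Y.supp_subset)
qed


section \<open>Algebras over the injection operad\<close>

declare One_nat_def [simp del]

section \<open>Positions in a concatenation of blocks\<close>

lemma block_eq:
  assumes "m \<in> {1..k}" "sum ns {1..<m} < i" "i \<le> sum ns {1..m}"
  shows "block k ns i = m"
  unfolding block_def
proof (rule the_equality)
  fix m' assume m': "m' \<in> {1..k} \<and> sum ns {1..<m'} < i \<and> i \<le> sum ns {1..m'}"
  \<comment> \<open>A block ends no later than any later block starts, so the half-open intervals
    are disjoint and a position cannot lie in two of them.\<close>
  have mono: "sum ns {1..a} \<le> sum ns {1..<b}" if "a < b" for a b
    using that by (intro sum_mono2) auto
  show "m' = m" using mono [of m m'] mono [of m' m] m' assms(2,3) by (cases m m' rule: linorder_cases) auto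
qed (use assms in auto)

text \<open>Facts about a given algebra are extracted from the associativity axiom in three shapes:
  one block, which is postcomposition with an injection; blocks of length one, which is
  precomposition in the slots; and two blocks, which is the joining of two tuples. This lemma and
  the next two compute the block coordinates for these shapes.\<close>

lemma
  assumes "i \<in> {1..ns 1}"
  shows block_one: "block 1 ns i = 1" and block_pos_one: "block_pos 1 ns i = i"
proof -
  show "block 1 ns i = 1" using assms by (intro block_eq) auto
  then show "block_pos 1 ns i = i" by (simp add: block_pos_def)
qed

lemma
  assumes "i \<in> {1..k}"
  shows block_singletons: "block k (\<lambda>_. 1) i = i" and block_pos_singletons: "block_pos k (\<lambda>_. 1) i = 1"
proof -
  show "block k (\<lambda>_. 1) i = i" using assms by (intro block_eq) auto
  then show "block_pos k (\<lambda>_. 1) i = 1" using assms by (simp add: block_pos_def)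
qed

lemma
  assumes "i \<in> {1..ns 1 + ns 2}"
  shows block_two: "block 2 ns i = (if i \<le> ns 1 then 1 else 2)"
    and block_pos_two: "block_pos 2 ns i = (if i \<le> ns 1 then i else i - ns 1)"
proof -
  have *: "{1..<2} = {1::nat}" "{1..2} = {1, 2::nat}" by auto
  show b: "block 2 ns i = (if i \<le> ns 1 then 1 else 2)"
    using assms * by (intro block_eq) auto
  then show "block_pos 2 ns i = (if i \<le> ns 1 then i else i - ns 1)"
    using * by (simp add: block_pos_def)
qed

lemma op_comp_eqI:
  assumes "sum ns {1..k} = N"
    and "\<And>i j. i \<in> {1..N} \<Longrightarrow> \<phi> (block k ns i, \<psi> (block k ns i) (block_pos k ns i, j)) = g (i, j)"
  shows "op_comp k ns \<phi> \<psi> = restrict g ({1..N} \<times> UNIV)"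
  unfolding op_comp_def assms(1) by (intro restrict_ext) (use assms(2) in fastforce)

lemma tuple_concat_eqI:
  assumes "sum ns {1..k} = N" "z \<in> extensional {1..N}"
    and "\<And>i. i \<in> {1..N} \<Longrightarrow> x (block k ns i) (block_pos k ns i) = z i"
  shows "tuple_concat k ns x = z"
  unfolding tuple_concat_def assms(1)
  by (rule extensionalityI [where A = "{1..N}"]) (use assms(2,3) in auto)

section \<open>Injectivity of operations and of their modifications\<close>

lemma inj_op_eq_iff:
  "\<phi> \<in> inj_op n \<Longrightarrow> i \<in> {1..n} \<Longrightarrow> i' \<in> {1..n} \<Longrightarrow> \<phi> (i, j) = \<phi> (i', j') \<longleftrightarrow> i = i' \<and> j = j'"
  unfolding inj_op_def using inj_on_eq_iff [of \<phi> "{1..n} \<times> UNIV" "(i, j)" "(i', j')"] by auto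

lemma inj_op_slot: "\<phi> \<in> inj_op n \<Longrightarrow> i \<in> {1..n} \<Longrightarrow> inj (\<lambda>j. \<phi> (i, j))"
  by (simp add: inj_def inj_op_eq_iff)

lemma inj_opI:
  assumes "\<And>i j i' j'. i \<in> {1..n} \<Longrightarrow> i' \<in> {1..n} \<Longrightarrow> g (i, j) = g (i', j') \<Longrightarrow> i = i' \<and> j = j'"
  shows "restrict g ({1..n} \<times> UNIV) \<in> inj_op n"
proof -
  have "p = q" if "p \<in> {1..n} \<times> UNIV" "q \<in> {1..n} \<times> UNIV" "g p = g q" for p q
    using assms [of "fst p" "fst q" "snd p" "snd q"] that by (simp add: mem_Times_iff prod_eq_iff)
  then show ?thesis unfolding inj_op_def by (auto intro!: inj_onI)
qed

lemma inj_op_slots: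
  assumes "\<phi> \<in> inj_op n" "\<And>i. i \<in> {1..n} \<Longrightarrow> inj (f i)"
  shows "(\<lambda>(i, j)\<in>{1..n} \<times> UNIV. \<phi> (i, f i j)) \<in> inj_op n"
proof (rule inj_opI)
  fix i j i' j' assume i: "i \<in> {1..n}" "i' \<in> {1..n}"
    and eq: "(case (i, j) of (i, j) \<Rightarrow> \<phi> (i, f i j)) = (case (i', j') of (i, j) \<Rightarrow> \<phi> (i, f i j))"
  have "\<phi> (i, f i j) = \<phi> (i', f i' j')" using eq by simp
  then have "i = i' \<and> f i j = f i' j'" by (rule iffD1 [OF inj_op_eq_iff [OF assms(1) i]])
  then show "i = i' \<and> j = j'" using injD [OF assms(2) [OF i(1)]] by metis
qed

lemma op_of_inj_mem: "inj f \<Longrightarrow> op_of_inj f \<in> inj_op 1"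
  unfolding op_of_inj_def by (intro inj_opI) (auto simp: inj_eq)

lemma inj_op_post:
  assumes "\<phi> \<in> inj_op n" "inj f"
  shows "(\<lambda>(i, j)\<in>{1..n} \<times> UNIV. f (\<phi> (i, j))) \<in> inj_op n"
proof (rule inj_opI)
  fix i j i' j' assume i: "i \<in> {1..n}" "i' \<in> {1..n}"
    and "(case (i, j) of (i, j) \<Rightarrow> f (\<phi> (i, j))) = (case (i', j') of (i, j) \<Rightarrow> f (\<phi> (i, j)))"
  then have "\<phi> (i, j) = \<phi> (i', j')" using assms(2) by (simp add: inj_eq)
  then show "i = i' \<and> j = j'" by (rule iffD1 [OF inj_op_eq_iff [OF assms(1) i]])
qed

lemma op_perm_mem:
  assumes \<phi>: "\<phi> \<in> inj_op n" and \<sigma>: "\<sigma> permutes {1..n}"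
  shows "op_perm n \<phi> \<sigma> \<in> inj_op n"
  unfolding op_perm_def
proof (rule inj_opI)
  fix i j i' j' assume i: "i \<in> {1..n}" "i' \<in> {1..n}"
    and "(case (i, j) of (i, j) \<Rightarrow> \<phi> (\<sigma> i, j)) = (case (i', j') of (i, j) \<Rightarrow> \<phi> (\<sigma> i, j))"
  then have eq: "\<phi> (\<sigma> i, j) = \<phi> (\<sigma> i', j')" by simp
  have "\<sigma> i \<in> {1..n}" "\<sigma> i' \<in> {1..n}" using i permutes_in_image [OF \<sigma>] by blast+
  then have "\<sigma> i = \<sigma> i' \<and> j = j'" by (rule iffD1 [OF inj_op_eq_iff [OF \<phi>] eq])
  then show "i = i' \<and> j = j'" using permutes_inj [OF \<sigma>] by (simp add: inj_eq)
qed

lemma op_unit_mem: "op_unit \<in> inj_op 1"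
  unfolding op_unit_def by (rule inj_opI) simp

lemma inj_op_0: "inj_op 0 = {\<lambda>_. undefined}"
  by (auto simp: inj_op_def)

section \<open>Operations on a tame algebra and their dependence on supports\<close>

locale tame_op_set =
  fixes X :: "'a op_set"
  assumes tame_op: "is_tame_op_set X"
begin

abbreviation "U \<equiv> underlying X"

sublocale tame_M_set U
  using tame_op by unfold_locales (simp add: is_tame_op_set_def)

lemma mcarrier_underlying [simp]: "mcarrier U = acarrier X"
  by (simp add: underlying_def)

lemma act_underlying:
  "inj f \<Longrightarrow> x \<in> acarrier X \<Longrightarrow> mact U f x = aact X 1 (op_of_inj f) (\<lambda>i\<in>{1..1}. x)"
  by (simp add: underlying_def)

lemma op_act_PiE: "aact X n \<in> inj_op n \<rightarrow>\<^sub>E (tuples X n \<rightarrow>\<^sub>E acarrier X)"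
  using tame_op unfolding is_tame_op_set_def is_op_set_def by blast

lemma op_act_closed: "\<phi> \<in> inj_op n \<Longrightarrow> x \<in> tuples X n \<Longrightarrow> aact X n \<phi> x \<in> acarrier X"
  by (rule PiE_mem [OF PiE_mem [OF op_act_PiE]])

lemma op_act_assoc:
  assumes "\<phi> \<in> inj_op k" "\<And>m. m \<in> {1..k} \<Longrightarrow> \<psi> m \<in> inj_op (ns m)"
    and "\<And>m. m \<in> {1..k} \<Longrightarrow> x m \<in> tuples X (ns m)"
  shows "aact X (sum ns {1..k}) (op_comp k ns \<phi> \<psi>) (tuple_concat k ns x) =
    aact X k \<phi> (\<lambda>m\<in>{1..k}. aact X (ns m) (\<psi> m) (x m))"
proof -
  have "\<forall>k ns \<phi> \<psi> x. \<phi> \<in> inj_op k \<longrightarrow> (\<forall>m\<in>{1..k}. \<psi> m \<in> inj_op (ns m)) \<longrightarrow>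
      (\<forall>m\<in>{1..k}. x m \<in> tuples X (ns m)) \<longrightarrow>
      aact X (sum ns {1..k}) (op_comp k ns \<phi> \<psi>) (tuple_concat k ns x) =
      aact X k \<phi> (\<lambda>m\<in>{1..k}. aact X (ns m) (\<psi> m) (x m))"
    using tame_op unfolding is_tame_op_set_def is_op_set_def by (elim conjE)
  then show ?thesis using assms by blast
qed

lemma op_act_perm:
  assumes "\<phi> \<in> inj_op n" "\<sigma> permutes {1..n}" "x \<in> tuples X n"
  shows "aact X n (op_perm n \<phi> \<sigma>) x = aact X n \<phi> (\<lambda>i\<in>{1..n}. x (inv \<sigma> i))"
  using tame_op assms unfolding is_tame_op_set_def is_op_set_def by blast

text \<open>Associativity with a single block, the outer operation being the unary one given by
  \<open>f\<close>.\<close>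

lemma act_op_act:
  assumes f: "inj f" and \<phi>: "\<phi> \<in> inj_op n" and x: "x \<in> tuples X n"
  shows "mact U f (aact X n \<phi> x) = aact X n (\<lambda>(i, j)\<in>{1..n} \<times> UNIV. f (\<phi> (i, j))) x"
proof -
  have ext: "x \<in> extensional {1..n}" using x by (simp add: tuples_def PiE_def)
  have "op_comp 1 (\<lambda>_. n) (op_of_inj f) (\<lambda>_. \<phi>) = (\<lambda>(i, j)\<in>{1..n} \<times> UNIV. f (\<phi> (i, j)))"
    by (rule op_comp_eqI) (simp_all add: block_one block_pos_one op_of_inj_def)
  moreover have "tuple_concat 1 (\<lambda>_. n) (\<lambda>_. x) = x"
    by (rule tuple_concat_eqI [OF _ ext]) (simp_all add: block_pos_one)
  ultimately show ?thesis
    using op_act_assoc [of "op_of_inj f" 1 "\<lambda>_. \<phi>" "\<lambda>_. n" "\<lambda>_. x"] assms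
    by (simp add: act_underlying op_act_closed op_of_inj_mem)
qed

text \<open>Associativity with \<open>n\<close> blocks of length one. The injections
  \<open>f i\<close> may differ from slot to slot, which lets each slot be adapted to the support of
  its own entry.\<close>

lemma op_act_slots:
  assumes \<phi>: "\<phi> \<in> inj_op n" and x: "x \<in> tuples X n" and f: "\<And>i. i \<in> {1..n} \<Longrightarrow> inj (f i)"
  shows "aact X n \<phi> (\<lambda>i\<in>{1..n}. mact U (f i) (x i)) = aact X n (\<lambda>(i, j)\<in>{1..n} \<times> UNIV. \<phi> (i, f i j)) x"
proof -
  have ext: "x \<in> extensional {1..n}" using x by (simp add: tuples_def PiE_def)
  have xi: "x i \<in> acarrier X" if "i \<in> {1..n}" for i using x that by (auto simp: tuples_def)
  have "op_comp n (\<lambda>_. 1) \<phi> (\<lambda>i. op_of_inj (f i)) = (\<lambda>(i, j)\<in>{1..n} \<times> UNIV. \<phi> (i, f i j))"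
    by (rule op_comp_eqI) (simp_all add: block_singletons block_pos_singletons op_of_inj_def)
  moreover have "tuple_concat n (\<lambda>_. 1) (\<lambda>i. \<lambda>_\<in>{1..1}. x i) = x"
    by (rule tuple_concat_eqI [OF _ ext]) (simp_all add: block_singletons block_pos_singletons)
  moreover have "(\<lambda>i\<in>{1..n}. aact X 1 (op_of_inj (f i)) (\<lambda>_\<in>{1..1}. x i)) = (\<lambda>i\<in>{1..n}. mact U (f i) (x i))"
    using f xi by (intro restrict_ext) (simp add: act_underlying)
  moreover have "aact X (sum (\<lambda>_. 1) {1..n}) (op_comp n (\<lambda>_. 1) \<phi> (\<lambda>i. op_of_inj (f i)))
      (tuple_concat n (\<lambda>_. 1) (\<lambda>i. \<lambda>_\<in>{1..1}. x i)) =
    aact X n \<phi> (\<lambda>i\<in>{1..n}. aact X 1 (op_of_inj (f i)) (\<lambda>_\<in>{1..1}. x i))"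
    using \<phi> xi f op_of_inj_mem by (intro op_act_assoc) (auto simp: tuples_def)
  ultimately show ?thesis by simp
qed

text \<open>Outside \<open>C\<close> the composite of \<open>f\<close> and \<open>\<psi>\<close>
  depends on the index \<open>(i, j)\<close> alone and no longer on \<open>\<psi>\<close>. This is
  what lets two different operations arrive at the same normal form.\<close>

lemma push_off:
  assumes \<psi>: "\<psi> \<in> inj_op n" and r: "inj r" "\<And>i. r i \<notin> C"
  obtains f where "inj f" "\<And>a. a \<in> C \<Longrightarrow> f a = a"
    "\<And>i j. i \<in> {1..n} \<Longrightarrow> \<psi> (i, j) \<notin> C \<Longrightarrow> f (\<psi> (i, j)) = r (2 * prod_encode (i, Rep_omega j))"
proof -
  let ?D = "{1..n} \<times> (UNIV :: omega set)"
  let ?c = "\<lambda>p. prod_encode (fst p, Rep_omega (snd p))"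
  let ?inv = "the_inv_into ?D \<psi>"
  \<comment> \<open>Even codes name the points hit by \<open>\<psi>\<close>, through their unique
    preimages; odd codes name the points it misses. The split by parity keeps \<open>f\<close>
    injective on all of \<omega>, not only on the image of \<open>\<psi>\<close>.\<close>
  define g where "g a = (if a \<in> \<psi> ` ?D then 2 * ?c (?inv a) else Suc (2 * Rep_omega a))" for a
  let ?f = "\<lambda>a. if a \<in> C then a else r (g a)"
  have inj: "inj_on \<psi> ?D" using \<psi> by (simp add: inj_op_def)
  have parity: "2 * m \<noteq> Suc (2 * k)" for m k :: nat by presburger
  have code: "p = q" if "?c p = ?c q" for p q
    using that by (simp add: prod_encode_eq Rep_omega_inject prod_eq_iff)
  have "a = b" if "g a = g b" for a b
  proof (cases "a \<in> \<psi> ` ?D \<longleftrightarrow> b \<in> \<psi> ` ?D")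
    case True
    show ?thesis
    proof (cases "a \<in> \<psi> ` ?D")
      case a: True
      then have b: "b \<in> \<psi> ` ?D" using True by blast
      have "?inv a = ?inv b" by (rule code) (use that a b in \<open>simp add: g_def\<close>)
      then show ?thesis
        using f_the_inv_into_f [OF inj a] f_the_inv_into_f [OF inj b] by metis
    qed (use that True in \<open>simp add: g_def Rep_omega_inject\<close>)
  next
    case False
    then show ?thesis using that parity [of "?c (?inv a)"] parity [of "?c (?inv b)"]
      unfolding g_def by (metis (no_types, lifting))
  qed
  then have "inj ?f" using r(2) inj_eq [OF r(1)] by (intro injI) (metis (no_types, lifting))
  moreover have "?f (\<psi> (i, j)) = r (2 * prod_encode (i, Rep_omega j))"
    if "i \<in> {1..n}" "\<psi> (i, j) \<notin> C" for i j
    using that the_inv_into_f_f [OF inj, of "(i, j)"] by (auto simp: g_def)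
  ultimately show thesis using that [of ?f] by simp
qed

text \<open>
  Restricting the slots pushes everything but the supports away from a finite set \<open>C\<close> on which
  both values are supported; an injection fixing \<open>C\<close> then makes the two operations equal.
\<close>

lemma op_act_cong:
  assumes \<phi>: "\<phi> \<in> inj_op n" and \<phi>': "\<phi>' \<in> inj_op n" and x: "x \<in> tuples X n"
    and eq: "\<And>i j. i \<in> {1..n} \<Longrightarrow> j \<in> supp U (x i) \<Longrightarrow> \<phi> (i, j) = \<phi>' (i, j)"
  shows "aact X n \<phi> x = aact X n \<phi>' x"
proof -
  let ?A = "Sigma {1..n} (\<lambda>i. supp U (x i))"
  have xi: "x i \<in> acarrier X" if "i \<in> {1..n}" for i using x that by (auto simp: tuples_def)
  \<comment> \<open>The first part collects the values of either operation on the supports of the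
    entries, where the two agree. The other two parts ensure that an injection fixing
    \<open>C\<close> leaves both results unchanged.\<close>
  define C where "C = \<phi> ` ?A \<union> supp U (aact X n \<phi> x) \<union> supp U (aact X n \<phi>' x)"
  have "finite ?A" using xi by (intro finite_SigmaI) auto
  then have "finite C" using op_act_closed \<phi> \<phi>' x by (simp add: C_def)
  obtain r :: "nat \<Rightarrow> omega" where r: "inj r" "\<And>i. r i \<notin> C"
    using obtain_fresh_sequence [OF \<open>finite C\<close>] by blast
  have "\<exists>f. inj f \<and> (\<forall>j\<in>supp U (x i). f j = j) \<and>
      (\<forall>j. j \<notin> supp U (x i) \<longrightarrow> \<phi> (i, f j) \<notin> C \<and> \<phi>' (i, f j) \<notin> C)" if i: "i \<in> {1..n}" for i
  proof -
    \<comment> \<open>The arguments in slot \<open>i\<close> that one of the operations sends into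
      \<open>C\<close> are finitely many, because the slots are injective; \<open>f\<close> steers
      all arguments outside the support around them.\<close>
    let ?D = "supp U (x i) \<union> (\<lambda>j. \<phi> (i, j)) -` C \<union> (\<lambda>j. \<phi>' (i, j)) -` C"
    have "finite ?D"
      using xi i \<open>finite C\<close> inj_op_slot \<phi> \<phi>' by (simp add: finite_vimageI)
    then obtain f where "inj f" "\<And>j. j \<in> supp U (x i) \<Longrightarrow> f j = j" "\<And>j. j \<notin> supp U (x i) \<Longrightarrow> f j \<notin> ?D"
      using obtain_avoiding_inj [of ?D "supp U (x i)"] by blast
    then show ?thesis by (intro exI [of _ f]) auto
  qed
  then have "\<exists>f. \<forall>i\<in>{1..n}. inj (f i) \<and> (\<forall>j\<in>supp U (x i). f i j = j) \<and>
      (\<forall>j. j \<notin> supp U (x i) \<longrightarrow> \<phi> (i, f i j) \<notin> C \<and> \<phi>' (i, f i j) \<notin> C)"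
    by (intro bchoice ballI)
  then obtain f where f: "\<And>i. i \<in> {1..n} \<Longrightarrow> inj (f i)"
      "\<And>i j. i \<in> {1..n} \<Longrightarrow> j \<in> supp U (x i) \<Longrightarrow> f i j = j"
      "\<And>i j. i \<in> {1..n} \<Longrightarrow> j \<notin> supp U (x i) \<Longrightarrow> \<phi> (i, f i j) \<notin> C \<and> \<phi>' (i, f i j) \<notin> C"
    by blast
  \<comment> \<open>The normal form: after the slots are reindexed by \<open>f\<close>, a value in
    \<open>C\<close> is kept and any other value is replaced by the fresh point coding its
    index.\<close>
  define norm where "norm \<chi> = (\<lambda>(i, j)\<in>{1..n} \<times> UNIV. if \<chi> (i, f i j) \<in> C then \<chi> (i, f i j)
    else r (2 * prod_encode (i, Rep_omega j)))" for \<chi>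
  have key: "aact X n \<chi> x = aact X n (norm \<chi>) x"
    if \<chi>: "\<chi> \<in> inj_op n" and C: "supp U (aact X n \<chi> x) \<subseteq> C" for \<chi>
  proof -
    let ?\<psi> = "\<lambda>(i, j)\<in>{1..n} \<times> UNIV. \<chi> (i, f i j)"
    have \<psi>: "?\<psi> \<in> inj_op n"
      by (rule inj_op_slots [OF \<chi> f(1)])
    have "(\<lambda>i\<in>{1..n}. mact U (f i) (x i)) = x"
    proof (rule extensionalityI [where A = "{1..n}"])
      fix i assume i: "i \<in> {1..n}"
      have "mact U (f i) (x i) = x i" using f(1,2) [OF i] xi [OF i] by (intro act_fix) simp_all
      then show "(\<lambda>i\<in>{1..n}. mact U (f i) (x i)) i = x i" using i by simp
    qed (use x in \<open>auto simp: tuples_def PiE_def\<close>)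
    then have 1: "aact X n \<chi> x = aact X n ?\<psi> x" using op_act_slots [where f = f, OF \<chi> x] f(1) by simp
    obtain g where g: "inj g" "\<And>a. a \<in> C \<Longrightarrow> g a = a"
      "\<And>i j. i \<in> {1..n} \<Longrightarrow> ?\<psi> (i, j) \<notin> C \<Longrightarrow> g (?\<psi> (i, j)) = r (2 * prod_encode (i, Rep_omega j))"
      using push_off [OF \<psi> r] by blast
    have "aact X n \<chi> x = mact U g (aact X n \<chi> x)"
      using C g by (subst act_fix) (auto simp: op_act_closed \<chi> x)
    also have "\<dots> = aact X n (\<lambda>(i, j)\<in>{1..n} \<times> UNIV. g (?\<psi> (i, j))) x"
      unfolding 1 by (rule act_op_act [OF g(1) \<psi> x])
    also have "(\<lambda>(i, j)\<in>{1..n} \<times> UNIV. g (?\<psi> (i, j))) = norm \<chi>"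
      unfolding norm_def using g by (intro restrict_ext) auto
    finally show ?thesis .
  qed
  \<comment> \<open>For \<open>j\<close> in the support, \<open>f i j = j\<close> and both
    operations have the same value there. For every other \<open>j\<close> both values lie outside
    \<open>C\<close>, and both are replaced by the same coded point.\<close>
  have "norm \<phi> = norm \<phi>'"
    unfolding norm_def
  proof (intro restrict_ext, clarify)
    fix i j assume i: "i \<in> {1..n}"
    show "(if \<phi> (i, f i j) \<in> C then \<phi> (i, f i j) else r (2 * prod_encode (i, Rep_omega j))) =
      (if \<phi>' (i, f i j) \<in> C then \<phi>' (i, f i j) else r (2 * prod_encode (i, Rep_omega j)))"
      using f(2,3) [OF i, of j] eq [OF i, of j] by (cases "j \<in> supp U (x i)") auto
  qed
  moreover have "supp U (aact X n \<phi> x) \<subseteq> C" "supp U (aact X n \<phi>' x) \<subseteq> C" by (auto simp: C_def)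
  ultimately show ?thesis using key [OF \<phi>] key [OF \<phi>'] by metis
qed

end


section \<open>The sum of a tame algebra\<close>

definition join_tuple :: "nat \<Rightarrow> nat \<Rightarrow> (nat \<Rightarrow> 'a) \<Rightarrow> (nat \<Rightarrow> 'a) \<Rightarrow> (nat \<Rightarrow> 'a)" where
  "join_tuple a b x y = (\<lambda>i\<in>{1..a + b}. if i \<le> a then x i else y (i - a))"

lemma atLeastAtMost_1_2: "{1..2} = {1, 2::nat}"
  by auto

lemma pair_tuple_simps [simp]: "pair_tuple x y 1 = x" "pair_tuple x y 2 = y"
  by (simp_all add: pair_tuple_def)

lemma obtain_fixing_op_pair:
  assumes "finite A" "finite B" "A \<inter> B = {}"
  obtains \<psi> where "\<psi> \<in> inj_op 2" "\<And>j. j \<in> A \<Longrightarrow> \<psi> (1, j) = j" "\<And>j. j \<in> B \<Longrightarrow> \<psi> (2, j) = j"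
proof (rule obtain_fixing_op [of 2 "\<lambda>i. if i = 1 then A else B"])
  fix \<psi> assume "\<psi> \<in> inj_op 2" "\<And>i j. i \<in> {1..2} \<Longrightarrow> j \<in> (if i = 1 then A else B) \<Longrightarrow> \<psi> (i, j) = j"
  from this(1) this(2) [of 1] this(2) [of 2] show thesis by (intro that [of \<psi>]) simp_all
qed (use assms in \<open>auto simp: atLeastAtMost_1_2\<close>)

context tame_op_set
begin

text \<open>The admissibility condition of the binary sum in arity \<open>n\<close>. Since
  operations in \<open>inj_op n\<close> are injective, for them it forces the entries of
  \<open>x\<close> to have pairwise disjoint supports.\<close>

definition fixes_supports :: "nat \<Rightarrow> (nat \<times> omega \<Rightarrow> omega) \<Rightarrow> (nat \<Rightarrow> 'a) \<Rightarrow> bool" where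
  "fixes_supports n \<phi> x \<longleftrightarrow> (\<forall>i\<in>{1..n}. \<forall>j\<in>supp U (x i). \<phi> (i, j) = j)"

lemma tuples_mem: "x \<in> tuples X n \<Longrightarrow> i \<in> {1..n} \<Longrightarrow> x i \<in> acarrier X"
  unfolding tuples_def by (rule PiE_mem)

lemma pair_tuple_mem: "x \<in> acarrier X \<Longrightarrow> y \<in> acarrier X \<Longrightarrow> pair_tuple x y \<in> tuples X 2"
  unfolding tuples_def pair_tuple_def by (rule restrict_PiE_iff [THEN iffD2]) simp

lemma join_tuple_mem:
  "x \<in> tuples X a \<Longrightarrow> y \<in> tuples X b \<Longrightarrow> join_tuple a b x y \<in> tuples X (a + b)"
  unfolding tuples_def join_tuple_def
proof (rule restrict_PiE_iff [THEN iffD2], rule ballI)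
  fix i assume xy: "x \<in> {1..a} \<rightarrow>\<^sub>E acarrier X" "y \<in> {1..b} \<rightarrow>\<^sub>E acarrier X" and i: "i \<in> {1..a + b}"
  show "(if i \<le> a then x i else y (i - a)) \<in> acarrier X"
  proof (cases "i \<le> a")
    case False
    then have "i - a \<in> {1..b}" using i by auto
    then show ?thesis using PiE_mem [OF xy(2)] False by simp
  qed (use i PiE_mem [OF xy(1)] in simp)
qed

lemma op_act_join:
  assumes \<psi>: "\<psi> \<in> inj_op 2" and \<phi>: "\<phi> \<in> inj_op a" "\<phi>' \<in> inj_op b"
    and xy: "x \<in> tuples X a" "y \<in> tuples X b"
  shows "aact X 2 \<psi> (pair_tuple (aact X a \<phi> x) (aact X b \<phi>' y)) =
    aact X (a + b) (\<lambda>(i, j)\<in>{1..a + b} \<times> UNIV. if i \<le> a then \<psi> (1, \<phi> (i, j)) else \<psi> (2, \<phi>' (i - a, j)))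
      (join_tuple a b x y)"
proof -
  let ?ns = "\<lambda>m::nat. if m = 1 then a else b"
  let ?\<phi> = "\<lambda>m::nat. if m = 1 then \<phi> else \<phi>'"
  let ?x = "\<lambda>m::nat. if m = 1 then x else y"
  have sum: "sum ?ns {1..2} = a + b" by (simp add: atLeastAtMost_1_2)
  have "op_comp 2 ?ns \<psi> ?\<phi> =
      (\<lambda>(i, j)\<in>{1..a + b} \<times> UNIV. if i \<le> a then \<psi> (1, \<phi> (i, j)) else \<psi> (2, \<phi>' (i - a, j)))"
    by (rule op_comp_eqI [OF sum]) (simp add: block_two block_pos_two)
  moreover have "tuple_concat 2 ?ns ?x = join_tuple a b x y"
    by (rule tuple_concat_eqI [OF sum]) (simp_all add: block_two block_pos_two join_tuple_def)
  moreover have "(\<lambda>m\<in>{1..2}. aact X (?ns m) (?\<phi> m) (?x m)) = pair_tuple (aact X a \<phi> x) (aact X b \<phi>' y)"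
    unfolding pair_tuple_def by (rule restrict_ext) simp
  moreover have "aact X (sum ?ns {1..2}) (op_comp 2 ?ns \<psi> ?\<phi>) (tuple_concat 2 ?ns ?x) =
      aact X 2 \<psi> (\<lambda>m\<in>{1..2}. aact X (?ns m) (?\<phi> m) (?x m))"
    by (rule op_act_assoc [OF \<psi>]) (use \<phi> xy in simp_all)
  ultimately show ?thesis unfolding sum by simp
qed

text \<open>An injection \<open>f\<close> that fixes all these supports can be composed with
  \<open>\<phi>\<close> without changing \<open>\<phi>\<close> on them, so it fixes the
  value.\<close>

lemma supp_op_act:
  assumes \<phi>: "\<phi> \<in> inj_op n" and x: "x \<in> tuples X n" and fixed: "fixes_supports n \<phi> x"
  shows "supp U (aact X n \<phi> x) \<subseteq> (\<Union>i\<in>{1..n}. supp U (x i))"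
proof (rule supp_subset)
  show "supported_on U (aact X n \<phi> x) (\<Union>i\<in>{1..n}. supp U (x i))"
    unfolding supported_on_def
  proof (intro ballI impI)
    fix f assume f: "f \<in> inj_monoid" "\<forall>a\<in>\<Union>i\<in>{1..n}. supp U (x i). f a = a"
    have "(\<lambda>(i, j)\<in>{1..n} \<times> UNIV. f (\<phi> (i, j))) \<in> inj_op n"
      using inj_op_post [OF \<phi>] f(1) by simp
    then have "aact X n (\<lambda>(i, j)\<in>{1..n} \<times> UNIV. f (\<phi> (i, j))) x = aact X n \<phi> x"
      by (rule op_act_cong [OF _ \<phi> x]) (use f(2) fixed in \<open>auto simp: fixes_supports_def\<close>)
    then show "mact U f (aact X n \<phi> x) = aact X n \<phi> x" using act_op_act [OF _ \<phi> x] f(1) by simp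
  qed
qed (use tuples_mem [OF x] in simp)

text \<open>Any two admissible operations agree on the supports of \<open>x\<close> and
  \<open>y\<close>, hence have the same value. This makes the description in \<open>op_sum\<close>
  unique and lets a sum be computed with whichever admissible operation is convenient.\<close>

lemma op_sum_eq:
  assumes \<phi>: "\<phi> \<in> inj_op 2" and xy: "x \<in> acarrier X" "y \<in> acarrier X"
    and fixed: "\<And>j. j \<in> supp U x \<Longrightarrow> \<phi> (1, j) = j" "\<And>j. j \<in> supp U y \<Longrightarrow> \<phi> (2, j) = j"
  shows "op_sum X x y = aact X 2 \<phi> (pair_tuple x y)"
  unfolding op_sum_def
proof (rule the_equality)
  show "\<forall>\<phi>'\<in>inj_op 2. (\<forall>j\<in>supp U x. \<phi>' (1, j) = j) \<longrightarrow> (\<forall>j\<in>supp U y. \<phi>' (2, j) = j) \<longrightarrow>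
     aact X 2 \<phi> (pair_tuple x y) = aact X 2 \<phi>' (pair_tuple x y)"
  proof (intro ballI impI)
    fix \<phi>' assume \<phi>': "\<phi>' \<in> inj_op 2" "\<forall>j\<in>supp U x. \<phi>' (1, j) = j" "\<forall>j\<in>supp U y. \<phi>' (2, j) = j"
    show "aact X 2 \<phi> (pair_tuple x y) = aact X 2 \<phi>' (pair_tuple x y)"
      by (rule op_act_cong [OF \<phi> \<phi>'(1) pair_tuple_mem [OF xy]])
        (use fixed \<phi>'(2,3) in \<open>auto simp: atLeastAtMost_1_2\<close>)
  qed
qed (use \<phi> fixed in blast)

text \<open>A sum of two values is again the value of a single operation on the concatenated tuple,
  and that operation may be any \<open>\<Phi>\<close> fixing the supports. The unit law,
  associativity and the formula for \<open>n\<close> summands all become comparisons of such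
  values.\<close>

lemma op_sum_join:
  assumes \<Phi>: "\<Phi> \<in> inj_op (a + b)" and \<phi>: "\<phi> \<in> inj_op a" "\<phi>' \<in> inj_op b"
    and x: "x \<in> tuples X a" and y: "y \<in> tuples X b"
    and fix_\<Phi>: "fixes_supports (a + b) \<Phi> (join_tuple a b x y)"
    and fixed: "fixes_supports a \<phi> x" "fixes_supports b \<phi>' y"
  shows "op_sum X (aact X a \<phi> x) (aact X b \<phi>' y) = aact X (a + b) \<Phi> (join_tuple a b x y)"
proof -
  define A where "A = (\<Union>i\<in>{1..a}. supp U (x i))"
  define B where "B = (\<Union>i\<in>{1..b}. supp U (y i))"
  have fix_x: "\<Phi> (i, j) = j" if "i \<in> {1..a}" "j \<in> supp U (x i)" for i j
    using fix_\<Phi> that by (simp add: fixes_supports_def join_tuple_def)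
  have fix_y: "\<Phi> (a + i, j) = j" if "i \<in> {1..b}" "j \<in> supp U (y i)" for i j
    using fix_\<Phi> that by (auto simp: fixes_supports_def join_tuple_def dest: bspec [where x = "a + i"])
  \<comment> \<open>A common point \<open>j\<close> of two supports would be the value of
    \<open>\<Phi>\<close> at two different slots.\<close>
  have disj: "A \<inter> B = {}"
  proof (rule ccontr)
    assume "A \<inter> B \<noteq> {}"
    then obtain i i' j where i: "i \<in> {1..a}" "j \<in> supp U (x i)" "i' \<in> {1..b}" "j \<in> supp U (y i')"
      unfolding A_def B_def by blast
    have "i \<in> {1..a + b}" "a + i' \<in> {1..a + b}" using i(1,3) by simp_all
    moreover have "\<Phi> (i, j) = \<Phi> (a + i', j)" using fix_x fix_y i by simp
    ultimately have "i = a + i'" using inj_op_eq_iff [OF \<Phi>] by blast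
    then show False using i by simp
  qed
  have "finite A" "finite B" using tuples_mem [OF x] tuples_mem [OF y] by (auto simp: A_def B_def)
  then obtain \<psi> where \<psi>: "\<psi> \<in> inj_op 2" and \<psi>A: "\<And>j. j \<in> A \<Longrightarrow> \<psi> (1, j) = j"
      and \<psi>B: "\<And>j. j \<in> B \<Longrightarrow> \<psi> (2, j) = j"
    using obtain_fixing_op_pair [OF _ _ disj] by metis
  \<comment> \<open>The operadic composite of \<open>\<psi>\<close> with \<open>\<phi>\<close> and
    \<open>\<phi>'\<close>. Like \<open>\<Phi>\<close>, it returns \<open>j\<close> at every
    \<open>(i, j)\<close> with \<open>j\<close> in the support of entry \<open>i\<close>, and this
    agreement suffices.\<close>
  let ?J = "\<lambda>(i, j)\<in>{1..a + b} \<times> UNIV. if i \<le> a then \<psi> (1, \<phi> (i, j)) else \<psi> (2, \<phi>' (i - a, j))"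
  have "op_sum X (aact X a \<phi> x) (aact X b \<phi>' y) =
      aact X 2 \<psi> (pair_tuple (aact X a \<phi> x) (aact X b \<phi>' y))"
    using supp_op_act [OF \<phi>(1) x fixed(1)] supp_op_act [OF \<phi>(2) y fixed(2)] \<psi>A \<psi>B
    unfolding A_def B_def
    by (intro op_sum_eq \<psi> op_act_closed \<phi> x y) blast+
  also have "\<dots> = aact X (a + b) ?J (join_tuple a b x y)" by (rule op_act_join [OF \<psi> \<phi> x y])
  also have "\<dots> = aact X (a + b) \<Phi> (join_tuple a b x y)"
  proof (rule op_act_cong [OF _ \<Phi> join_tuple_mem [OF x y]])
    show "?J \<in> inj_op (a + b)"
    proof (rule inj_opI)
      fix i j i' j'
      assume i: "i \<in> {1..a + b}" "i' \<in> {1..a + b}"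
        and "(case (i, j) of (i, j) \<Rightarrow> if i \<le> a then \<psi> (1, \<phi> (i, j)) else \<psi> (2, \<phi>' (i - a, j))) =
         (case (i', j') of (i, j) \<Rightarrow> if i \<le> a then \<psi> (1, \<phi> (i, j)) else \<psi> (2, \<phi>' (i - a, j)))"
      then have eq: "(if i \<le> a then \<psi> (1, \<phi> (i, j)) else \<psi> (2, \<phi>' (i - a, j))) =
          (if i' \<le> a then \<psi> (1, \<phi> (i', j')) else \<psi> (2, \<phi>' (i' - a, j')))" by simp
      have \<psi>_eq: "\<psi> (k, l) = \<psi> (k', l') \<longleftrightarrow> k = k' \<and> l = l'" if "k \<in> {1, 2}" "k' \<in> {1, 2}" for k k' l l'
        using inj_op_eq_iff [OF \<psi>] that unfolding atLeastAtMost_1_2 by blast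
      show "i = i' \<and> j = j'"
      proof (cases "i \<le> a")
        case True
        then have "i' \<le> a" "\<phi> (i, j) = \<phi> (i', j')" using eq by (auto simp: \<psi>_eq split: if_splits)
        then show ?thesis using inj_op_eq_iff [OF \<phi>(1), of i i' j j'] True i by simp
      next
        case False
        then have "\<not> i' \<le> a" "\<phi>' (i - a, j) = \<phi>' (i' - a, j')" using eq by (auto simp: \<psi>_eq split: if_splits)
        then have "i - a \<in> {1..b}" "i' - a \<in> {1..b}" using False i by auto
        then have "i - a = i' - a \<and> j = j'"
          using inj_op_eq_iff [OF \<phi>(2)] \<open>\<phi>' (i - a, j) = \<phi>' (i' - a, j')\<close> by blast
        then show ?thesis using False \<open>\<not> i' \<le> a\<close> by auto
      qed
    qed
  next
    fix i j assume i: "i \<in> {1..a + b}" and j: "j \<in> supp U (join_tuple a b x y i)"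
    have "\<Phi> (i, j) = j" using fix_\<Phi> i j by (simp add: fixes_supports_def)
    moreover have "?J (i, j) = j"
    proof (cases "i \<le> a")
      case True
      then have *: "i \<in> {1..a}" "j \<in> supp U (x i)" using i j by (simp_all add: join_tuple_def)
      then have "j \<in> A" "\<phi> (i, j) = j" using fixed(1) by (auto simp: A_def fixes_supports_def)
      then show ?thesis using True i \<psi>A by simp
    next
      case False
      then have *: "i - a \<in> {1..b}" "j \<in> supp U (y (i - a))" using i j by (auto simp: join_tuple_def)
      then have "j \<in> B" "\<phi>' (i - a, j) = j" using fixed(2) by (auto simp: B_def fixes_supports_def)
      then show ?thesis using False i \<psi>B by simp
    qed
    ultimately show "?J (i, j) = \<Phi> (i, j)" by simp
  qed
  finally show ?thesis .
qed

end


section \<open>Finite sums in commutative monoids of tame \<open>M\<close>-sets\<close>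

lemma mcarrier_box [simp]: "mcarrier (X \<boxtimes> Y) = box_carrier X Y"
  by (simp add: box_def)

lemma act_box: "inj f \<Longrightarrow> p \<in> box_carrier X Y \<Longrightarrow> mact (X \<boxtimes> Y) f p = (mact X f (fst p), mact Y f (snd p))"
  by (simp add: box_def map_prod_def case_prod_beta)

lemma mcarrier_unit [simp]: "mcarrier unit_M_set = UNIV"
  by (simp add: unit_M_set_def)

lemma act_unit: "inj f \<Longrightarrow> mact unit_M_set f u = u"
  by (simp add: unit_M_set_def)

lemma supp_unit [simp]: "supp unit_M_set u = {}"
proof -
  have "supported_on unit_M_set u {}" by (simp add: supported_on_def act_unit)
  then show ?thesis unfolding supp_def by blast
qed

text \<open>An injection fixes a pair exactly when it fixes both components. The formula turns
  membership of \<open>((x, y), z)\<close> in the iterated product into disjointness of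
  \<open>z\<close> from \<open>x\<close> and from \<open>y\<close>.\<close>

lemma supp_box:
  assumes "is_tame_M_set X" "is_tame_M_set Y" and p: "(x, y) \<in> box_carrier X Y"
  shows "supp (X \<boxtimes> Y) (x, y) = supp X x \<union> supp Y y"
proof -
  interpret X: tame_M_set X by unfold_locales fact
  interpret Y: tame_M_set Y by unfold_locales fact
  have xy: "x \<in> mcarrier X" "y \<in> mcarrier Y" using p by (simp_all add: box_carrier_def)
  have supported: "supported_on (X \<boxtimes> Y) (x, y) A \<longleftrightarrow> supported_on X x A \<and> supported_on Y y A" for A
    using p by (auto simp: supported_on_def act_box)
  have "supported_on X x (supp X x \<union> supp Y y)" "supported_on Y y (supp X x \<union> supp Y y)"
    using X.supported_on_supp [OF xy(1)] Y.supported_on_supp [OF xy(2)] by (simp_all add: supported_on_def)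
  then have "supp (X \<boxtimes> Y) (x, y) \<subseteq> supp X x \<union> supp Y y"
    using xy unfolding supp_def [of "X \<boxtimes> Y"] by (intro Inter_lower) (simp add: supported)
  moreover have "supp X x \<union> supp Y y \<subseteq> supp (X \<boxtimes> Y) (x, y)"
    unfolding supp_def [of "X \<boxtimes> Y"] supported using X.supp_subset Y.supp_subset by blast
  ultimately show ?thesis by blast
qed

text \<open>Addition is meaningful only for disjoint supports, so a finite sum is written as a fold
  along the increasing enumeration of the index set. Its independence of the order is a theorem
  about families with pairwise disjoint supports.\<close>

definition monoid_sum :: "'a M_monoid \<Rightarrow> nat set \<Rightarrow> (nat \<Rightarrow> 'a) \<Rightarrow> 'a" where
  "monoid_sum R I y = foldr (\<lambda>i s. mult R (y i, s)) (sorted_list_of_set I) (neut R ())"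

lemma monoid_sum_cong: "(\<And>i. i \<in> I \<Longrightarrow> y i = y' i) \<Longrightarrow> monoid_sum R I y = monoid_sum R I y'"
  unfolding monoid_sum_def
  by (cases "finite I") (auto intro: foldr_cong)

locale tame_com_monoid =
  fixes R :: "'a M_monoid"
  assumes tame_com: "is_tame_com_monoid R"
begin

abbreviation "B \<equiv> base R"
abbreviation "C \<equiv> mcarrier (base R)"
abbreviation plus_R (infixl \<open>\<oplus>\<close> 65) where "x \<oplus> y \<equiv> mult R (x, y)"
abbreviation zero_R (\<open>\<zero>\<close>) where "\<zero> \<equiv> neut R ()"
abbreviation "apart x y \<equiv> supp B x \<inter> supp B y = {}"

sublocale tame_M_set B
  using tame_com by unfold_locales (simp add: is_tame_com_monoid_def Let_def)

lemma mult_hom: "mult R \<in> M_hom (B \<boxtimes> B) B"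
  and neut_hom: "neut R \<in> M_hom unit_M_set B"
  and mult_assoc: "\<forall>p\<in>mcarrier ((B \<boxtimes> B) \<boxtimes> B). mult R (map_prod (mult R) id p) = mult R (map_prod id (mult R) (assoc_map p))"
  and mult_unit: "\<forall>p\<in>mcarrier (unit_M_set \<boxtimes> B). mult R (map_prod (neut R) id p) = snd p"
  and mult_swap: "\<forall>p\<in>mcarrier (B \<boxtimes> B). mult R (prod.swap p) = mult R p"
  using tame_com unfolding is_tame_com_monoid_def Let_def by blast+

lemma plus_closed: "x \<in> C \<Longrightarrow> y \<in> C \<Longrightarrow> apart x y \<Longrightarrow> x \<oplus> y \<in> C"
  using mult_hom unfolding M_hom_def by (auto simp: box_carrier_def)

lemma act_plus: "inj f \<Longrightarrow> x \<in> C \<Longrightarrow> y \<in> C \<Longrightarrow> apart x y \<Longrightarrow> mact B f (x \<oplus> y) = mact B f x \<oplus> mact B f y"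
  using mult_hom unfolding M_hom_def by (auto simp: box_carrier_def act_box)

lemma supp_plus:
  assumes "x \<in> C" "y \<in> C" "apart x y"
  shows "supp B (x \<oplus> y) \<subseteq> supp B x \<union> supp B y"
proof (rule supp_subset)
  show "supported_on B (x \<oplus> y) (supp B x \<union> supp B y)"
    unfolding supported_on_def using assms by (simp add: act_plus act_fix)
qed (use assms in simp)

lemma plus_comm: "x \<in> C \<Longrightarrow> y \<in> C \<Longrightarrow> apart x y \<Longrightarrow> x \<oplus> y = y \<oplus> x"
  using mult_swap by (auto simp: box_carrier_def)

lemma plus_assoc:
  assumes "x \<in> C" "y \<in> C" "z \<in> C" "apart x y" "apart x z" "apart y z"
  shows "x \<oplus> y \<oplus> z = x \<oplus> (y \<oplus> z)"
proof -
  have p: "(x, y) \<in> box_carrier B B" using assms by (simp add: box_carrier_def)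
  have "supp (B \<boxtimes> B) (x, y) \<inter> supp B z = {}"
    using supp_box [OF tame tame p] assms(5,6) by auto
  then have "((x, y), z) \<in> mcarrier ((B \<boxtimes> B) \<boxtimes> B)"
    using p assms(3) unfolding mcarrier_box box_carrier_def [of "B \<boxtimes> B"] by simp
  then show ?thesis using mult_assoc by (auto simp: assoc_map_def)
qed

lemma zero_closed: "\<zero> \<in> C"
  using neut_hom unfolding M_hom_def by auto

lemma act_zero: "inj f \<Longrightarrow> mact B f \<zero> = \<zero>"
  using neut_hom unfolding M_hom_def by (auto simp: act_unit)

lemma supp_zero [simp]: "supp B \<zero> = {}"
  using supp_subset [of "{}" \<zero>] by (simp add: supported_on_def act_zero)

lemma zero_plus: "x \<in> C \<Longrightarrow> \<zero> \<oplus> x = x"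
  using mult_unit by (auto simp: box_carrier_def)

section \<open>Families with pairwise disjoint supports and their sums\<close>

definition independent :: "nat set \<Rightarrow> (nat \<Rightarrow> 'a) \<Rightarrow> bool" where
  "independent I y \<longleftrightarrow> (\<forall>i\<in>I. y i \<in> C) \<and> (\<forall>i\<in>I. \<forall>j\<in>I. i \<noteq> j \<longrightarrow> apart (y i) (y j))"

lemma independent_subset: "independent J y \<Longrightarrow> I \<subseteq> J \<Longrightarrow> independent I y"
  unfolding independent_def by blast

lemma independent_act:
  assumes "independent I y" "inj f"
  shows "independent I (\<lambda>i. mact B f (y i))"
proof -
  have "apart (mact B f (y i)) (mact B f (y j))" if "i \<in> I" "j \<in> I" "i \<noteq> j" for i j
  proof -
    have "y i \<in> C" "y j \<in> C" "apart (y i) (y j)" using assms(1) that by (simp_all add: independent_def)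
    moreover have "f ` supp B (y i) \<inter> f ` supp B (y j) = f ` (supp B (y i) \<inter> supp B (y j))"
      by (rule image_Int [OF assms(2), symmetric])
    ultimately show ?thesis
      using supp_act_subset [OF _ assms(2), of "y i"] supp_act_subset [OF _ assms(2), of "y j"]
        by auto
  qed
  then show ?thesis using assms by (simp add: independent_def)
qed

abbreviation "list_sum y xs \<equiv> foldr (\<lambda>i s. mult R (y i, s)) xs \<zero>"

text \<open>Closure and the bound on the support are proved together: adding the next term requires
  that it be disjoint from the partial sum, which is what the bound provides.\<close>

lemma list_sum_closed:
  "distinct xs \<Longrightarrow> independent (set xs) y \<Longrightarrow> list_sum y xs \<in> C \<and> supp B (list_sum y xs) \<subseteq> (\<Union>i\<in>set xs. supp B (y i))"
proof (induction xs)
  case Nil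
  show ?case by (simp add: zero_closed)
next
  case (Cons a xs)
  have IH: "list_sum y xs \<in> C" "supp B (list_sum y xs) \<subseteq> (\<Union>i\<in>set xs. supp B (y i))"
    using Cons independent_subset [of "set (a # xs)" y "set xs"] by auto
  have a: "y a \<in> C" "\<And>i. i \<in> set xs \<Longrightarrow> apart (y a) (y i)"
    using Cons.prems by (auto simp: independent_def)
  then have "apart (y a) (list_sum y xs)" using IH(2) by blast
  then show ?case using plus_closed [OF a(1) IH(1)] supp_plus [OF a(1) IH(1)] IH(2) by auto
qed

text \<open>Exchanging two neighbouring terms, by associativity and commutativity, is the source of
  order independence: a sum can then be built up by inserting an arbitrary index rather than the
  least one.\<close>

lemma list_sum_insort:
  "distinct (a # xs) \<Longrightarrow> independent (set (a # xs)) y \<Longrightarrow> list_sum y (insort a xs) = y a \<oplus> list_sum y xs"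
proof (induction xs)
  case (Cons b xs)
  have sub: "independent (set (a # xs)) y" "independent (set xs) y"
    using independent_subset [OF Cons.prems(2)] by auto
  have s: "list_sum y xs \<in> C" "supp B (list_sum y xs) \<subseteq> (\<Union>i\<in>set xs. supp B (y i))"
    using list_sum_closed [OF _ sub(2)] Cons.prems(1) by auto
  have ab: "y a \<in> C" "y b \<in> C" "apart (y a) (y b)" "apart (y b) (y a)"
    using Cons.prems by (auto simp: independent_def)
  have "apart (y a) (y i)" "apart (y b) (y i)" if "i \<in> set xs" for i
    using Cons.prems that by (auto simp: independent_def)
  then have ds: "apart (y a) (list_sum y xs)" "apart (y b) (list_sum y xs)" using s(2) by blast+
  have "y b \<oplus> (y a \<oplus> list_sum y xs) = y b \<oplus> y a \<oplus> list_sum y xs"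
    by (rule plus_assoc [symmetric]) (use ab s ds in blast)+
  also have "\<dots> = y a \<oplus> y b \<oplus> list_sum y xs" using plus_comm [of "y a" "y b"] ab by simp
  also have "\<dots> = y a \<oplus> (y b \<oplus> list_sum y xs)"
    by (rule plus_assoc) (use ab s ds in blast)+
  finally show ?case using Cons.IH [OF _ sub(1)] Cons.prems(1) by simp
qed simp

lemma monoid_sum_empty [simp]: "monoid_sum R {} y = \<zero>"
  by (simp add: monoid_sum_def)

lemma monoid_sum_insert:
  assumes "finite I" "i \<notin> I" "independent (insert i I) y"
  shows "monoid_sum R (insert i I) y = y i \<oplus> monoid_sum R I y"
  unfolding monoid_sum_def using list_sum_insort [of i "sorted_list_of_set I" y] assms by simp

lemma
  assumes "finite I" "independent I y"
  shows monoid_sum_closed: "monoid_sum R I y \<in> C"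
    and supp_monoid_sum: "supp B (monoid_sum R I y) \<subseteq> (\<Union>i\<in>I. supp B (y i))"
  using list_sum_closed [of "sorted_list_of_set I" y] assms unfolding monoid_sum_def by simp_all

lemma apart_monoid_sum:
  assumes "finite I" "i \<notin> I" "independent (insert i I) y"
  shows "apart (y i) (monoid_sum R I y)"
proof -
  have "apart (y i) (y k)" if "k \<in> I" for k using assms(2,3) that by (auto simp: independent_def)
  then show ?thesis using supp_monoid_sum [OF assms(1)] independent_subset [OF assms(3)] by blast
qed

lemma monoid_sum_singleton: "y i \<in> C \<Longrightarrow> monoid_sum R {i} y = y i"
  using monoid_sum_insert [of "{}" i y] plus_comm [of "y i" \<zero>]
  by (simp add: independent_def zero_plus zero_closed)

lemma act_monoid_sum:
  assumes "inj f"
  shows "finite I \<Longrightarrow> independent I y \<Longrightarrow> mact B f (monoid_sum R I y) = monoid_sum R I (\<lambda>i. mact B f (y i))"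
proof (induction I rule: finite_induct)
  case (insert i I)
  have "independent I y" using insert.prems independent_subset by blast
  then show ?case
    using insert independent_act [OF insert.prems assms] monoid_sum_closed [of I y]
      apart_monoid_sum [OF insert.hyps insert.prems] insert.prems assms
    by (simp add: monoid_sum_insert act_plus independent_def)
qed (simp add: act_zero assms)

lemma monoid_sum_Un:
  assumes "finite J"
  shows "finite I \<Longrightarrow> I \<inter> J = {} \<Longrightarrow> independent (I \<union> J) y \<Longrightarrow>
    monoid_sum R (I \<union> J) y = monoid_sum R I y \<oplus> monoid_sum R J y"
proof (induction I rule: finite_induct)
  case empty
  then show ?case using monoid_sum_closed [OF assms] by (simp add: zero_plus)
next
  case (insert i I)
  have ind: "independent (I \<union> J) y" "independent (insert i I) y" "independent I y" "independent J y"
      "independent (insert i J) y"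
    using independent_subset [OF insert.prems(2)] by blast+
  have closed: "y i \<in> C" "monoid_sum R I y \<in> C" "monoid_sum R J y \<in> C"
    using insert.prems(2) ind monoid_sum_closed insert.hyps(1) assms by (auto simp: independent_def)
  have "i \<notin> J" using insert.prems(1) by blast
  have "apart (y k) (y l)" if "k \<in> I" "l \<in> J" for k l
  proof -
    have "k \<noteq> l" using that insert.prems(1) by blast
    then show ?thesis using that insert.prems(2) by (simp add: independent_def)
  qed
  then have d: "apart (monoid_sum R I y) (monoid_sum R J y)"
    using supp_monoid_sum [OF insert.hyps(1) ind(3)] supp_monoid_sum [OF assms ind(4)] by blast
  have "monoid_sum R (insert i I \<union> J) y = y i \<oplus> monoid_sum R (I \<union> J) y"
    using monoid_sum_insert [of "I \<union> J" i y] insert assms \<open>i \<notin> J\<close> by simp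
  also have "\<dots> = y i \<oplus> (monoid_sum R I y \<oplus> monoid_sum R J y)"
    using insert.IH insert.prems(1) ind(1) by simp
  also have "\<dots> = y i \<oplus> monoid_sum R I y \<oplus> monoid_sum R J y"
    using closed d apart_monoid_sum [OF insert.hyps ind(2)] apart_monoid_sum [OF assms \<open>i \<notin> J\<close> ind(5)]
    by (intro plus_assoc [symmetric])
  finally show ?case using monoid_sum_insert [OF insert.hyps ind(2)] by simp
qed

text \<open>\<open>g\<close> need not be monotone, so the two enumerations may order the terms
  differently; the insertion rule absorbs this. It serves both for shifting a block of indices and
  for permuting them.\<close>

lemma monoid_sum_image:
  "finite I \<Longrightarrow> inj_on g I \<Longrightarrow> independent (g ` I) y \<Longrightarrow>
    monoid_sum R (g ` I) y = monoid_sum R I (\<lambda>i. y (g i))"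
proof (induction I rule: finite_induct)
  case (insert i I)
  have "g i \<notin> g ` I" using insert.hyps insert.prems(1) by (auto simp: inj_on_def)
  moreover have "independent (g ` I) y" using independent_subset [OF insert.prems(2)] by blast
  moreover have "independent (insert i I) (\<lambda>i. y (g i))"
    using insert.prems inj_on_eq_iff [OF insert.prems(1)] by (simp add: independent_def)
  ultimately show ?case using insert by (simp add: monoid_sum_insert)
qed simp

end

text \<open>A morphism can only shrink supports, so the images of terms with disjoint supports again
  have disjoint supports and the right-hand sum obeys the insertion rule too.\<close>

lemma hom_monoid_sum:
  assumes "is_tame_com_monoid R" "is_tame_com_monoid S" and h: "h \<in> com_monoid_hom R S"
  shows "finite I \<Longrightarrow> tame_com_monoid.independent R I y \<Longrightarrow>
    h (monoid_sum R I y) = monoid_sum S I (\<lambda>i. h (y i))"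
proof (induction I rule: finite_induct)
  interpret R: tame_com_monoid R by unfold_locales fact
  interpret S: tame_com_monoid S by unfold_locales fact
  have h_M: "h \<in> M_hom (base R) (base S)" and h_zero: "h (neut R ()) = neut S ()"
    and h_plus: "\<And>p. p \<in> box_carrier (base R) (base R) \<Longrightarrow> h (mult R p) = mult S (map_prod h h p)"
    using h by (simp_all add: com_monoid_hom_def)
  {
    case empty
    show ?case using h_zero by simp
  next
    case (insert i I)
    have ind: "R.independent I y" using R.independent_subset [OF insert.prems] by blast
    have y: "y k \<in> mcarrier (base R)" if "k \<in> insert i I" for k
      using insert.prems that unfolding R.independent_def by blast
    have "supp (base S) (h (y k)) \<subseteq> supp (base R) (y k)" if "k \<in> insert i I" for k
      using supp_hom_subset [OF R.tame S.tame h_M y [OF that]] .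
    moreover have "h (y k) \<in> mcarrier (base S)" if "k \<in> insert i I" for k
      using h_M y [OF that] by (auto simp: M_hom_def)
    ultimately have "S.independent (insert i I) (\<lambda>k. h (y k))"
      using insert.prems unfolding R.independent_def S.independent_def by blast
    moreover have "(y i, monoid_sum R I y) \<in> box_carrier (base R) (base R)"
      using R.apart_monoid_sum [OF insert.hyps insert.prems] R.monoid_sum_closed [OF insert.hyps(1) ind] y
      by (simp add: box_carrier_def)
    ultimately show ?case
      using insert ind h_plus by (simp add: R.monoid_sum_insert S.monoid_sum_insert)
  }
qed


section \<open>The commutative monoid of a tame algebra\<close>

context tame_M_set
begin

text \<open>Distinct slots of an operation have disjoint images. Hence the terms of the sum formula
  are summable for every tuple, even when its entries coincide or their supports overlap.\<close>

lemma supp_slots_disjoint: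
  assumes \<phi>: "\<phi> \<in> inj_op n" and i: "i \<in> {1..n}" "i' \<in> {1..n}" "i \<noteq> i'"
    and x: "x \<in> mcarrier X" "x' \<in> mcarrier X"
  shows "supp X (mact X (\<lambda>j. \<phi> (i, j)) x) \<inter> supp X (mact X (\<lambda>j. \<phi> (i', j)) x') = {}"
proof -
  have "\<phi> (i, j) \<noteq> \<phi> (i', j')" for j j' using inj_op_eq_iff [OF \<phi> i(1,2)] i(3) by simp
  then show ?thesis
    using supp_act_subset [OF x(1) inj_op_slot [OF \<phi> i(1)]] supp_act_subset [OF x(2) inj_op_slot [OF \<phi> i(2)]]
    by blast
qed

end

context tame_op_set
begin

lemma op_act_unit: "x \<in> acarrier X \<Longrightarrow> aact X 1 op_unit (\<lambda>_\<in>{1..1}. x) = x"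
proof -
  assume "x \<in> acarrier X"
  then have "(\<lambda>_\<in>{1..1}. x) \<in> tuples X 1" by (simp add: tuples_def)
  moreover have "\<forall>x\<in>tuples X 1. aact X 1 op_unit x = x 1"
    using tame_op unfolding is_tame_op_set_def is_op_set_def by (elim conjE)
  ultimately have "aact X 1 op_unit (\<lambda>_\<in>{1..1}. x) = (\<lambda>_\<in>{1..1::nat}. x) 1" by (rule bspec [rotated])
  then show ?thesis by simp
qed

lemma single_tuple_mem: "x \<in> acarrier X \<Longrightarrow> (\<lambda>_\<in>{1..1}. x) \<in> tuples X 1"
  by (simp add: tuples_def)

lemma fixes_supports_unit: "fixes_supports 1 op_unit x"
  by (simp add: fixes_supports_def op_unit_def)

lemma empty_tuple_mem: "(\<lambda>_. undefined) \<in> tuples X 0"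
  by (simp add: tuples_def)

lemma op_zero_closed: "op_zero X \<in> acarrier X"
  unfolding op_zero_def by (rule op_act_closed) (simp_all add: inj_op_0 empty_tuple_mem)

lemma act_op_zero: "inj f \<Longrightarrow> mact U f (op_zero X) = op_zero X"
  unfolding op_zero_def using act_op_act [of f "\<lambda>_. undefined" 0 "\<lambda>_. undefined"]
  by (simp add: inj_op_0 empty_tuple_mem restrict_def)

context
  fixes x y assumes xy: "x \<in> acarrier X" "y \<in> acarrier X" "supp U x \<inter> supp U y = {}"
begin

lemma op_sum_witness:
  obtains \<phi> where "\<phi> \<in> inj_op 2" "fixes_supports 2 \<phi> (pair_tuple x y)" "op_sum X x y = aact X 2 \<phi> (pair_tuple x y)"
proof -
  obtain \<phi> where \<phi>: "\<phi> \<in> inj_op 2" "\<And>j. j \<in> supp U x \<Longrightarrow> \<phi> (1, j) = j" "\<And>j. j \<in> supp U y \<Longrightarrow> \<phi> (2, j) = j"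
    using obtain_fixing_op_pair [of "supp U x" "supp U y"] xy by auto
  moreover have "fixes_supports 2 \<phi> (pair_tuple x y)"
    using \<phi>(2,3) unfolding fixes_supports_def atLeastAtMost_1_2 by simp
  ultimately show thesis using that op_sum_eq xy(1,2) by simp
qed

lemma op_sum_closed: "op_sum X x y \<in> acarrier X"
  using op_sum_witness op_act_closed pair_tuple_mem xy(1,2) by metis

text \<open>If \<open>\<phi>\<close> is admissible for \<open>(x, y)\<close>, then
  \<open>\<phi>\<close> with its slots exchanged is admissible for \<open>(y, x)\<close>, and the
  equivariance axiom identifies the two values.\<close>

lemma op_sum_commute: "op_sum X y x = op_sum X x y"
proof -
  obtain \<phi> where \<phi>: "\<phi> \<in> inj_op 2" "fixes_supports 2 \<phi> (pair_tuple x y)" "op_sum X x y = aact X 2 \<phi> (pair_tuple x y)"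
    using op_sum_witness .
  let ?\<sigma> = "transpose 1 2 :: nat \<Rightarrow> nat"
  have \<sigma>: "?\<sigma> permutes {1..2}" by (rule permutes_swap_id) simp_all
  have fix_xy: "\<phi> (1, j) = j" if "j \<in> supp U x" for j using \<phi>(2) that by (auto simp: fixes_supports_def)
  have fix_yx: "\<phi> (2, j) = j" if "j \<in> supp U y" for j using \<phi>(2) that by (auto simp: fixes_supports_def)
  have "op_sum X y x = aact X 2 (op_perm 2 \<phi> ?\<sigma>) (pair_tuple y x)"
    by (rule op_sum_eq) (use op_perm_mem [OF \<phi>(1) \<sigma>] xy fix_xy fix_yx in \<open>simp_all add: op_perm_def\<close>)
  also have "\<dots> = aact X 2 \<phi> (\<lambda>i\<in>{1..2}. pair_tuple y x (inv ?\<sigma> i))"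
    by (rule op_act_perm [OF \<phi>(1) \<sigma> pair_tuple_mem]) (use xy in simp_all)
  also have "(\<lambda>i\<in>{1..2}. pair_tuple y x (inv ?\<sigma> i)) = pair_tuple x y"
    unfolding pair_tuple_def [of x y]
  proof (rule restrict_ext)
    fix i :: nat assume "i \<in> {1..2}"
    then consider "i = 1" | "i = 2" unfolding atLeastAtMost_1_2 by blast
    then show "pair_tuple y x (inv ?\<sigma> i) = (if i = 1 then x else y)" by cases simp_all
  qed
  finally show ?thesis using \<phi>(3) by simp
qed

text \<open>Both sides are values of binary operations on the same pair \<open>(x, y)\<close>: one
  applies \<open>f\<close> after an operation fixing the supports, the other applies
  \<open>f\<close> in the slots before an operation fixing the images of the supports. On the
  supports both give \<open>f j\<close>.\<close>

lemma act_op_sum: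
  assumes f: "inj f"
  shows "mact U f (op_sum X x y) = op_sum X (mact U f x) (mact U f y)"
proof -
  obtain \<phi> where \<phi>: "\<phi> \<in> inj_op 2" "fixes_supports 2 \<phi> (pair_tuple x y)" "op_sum X x y = aact X 2 \<phi> (pair_tuple x y)"
    using op_sum_witness .
  have p: "pair_tuple x y \<in> tuples X 2" using pair_tuple_mem xy by blast
  have "f ` supp U x \<inter> f ` supp U y = {}" using xy(3) image_Int [OF f] by (metis image_empty)
  then obtain \<psi> where \<psi>: "\<psi> \<in> inj_op 2" "\<And>j. j \<in> f ` supp U x \<Longrightarrow> \<psi> (1, j) = j" "\<And>j. j \<in> f ` supp U y \<Longrightarrow> \<psi> (2, j) = j"
    using obtain_fixing_op_pair [of "f ` supp U x" "f ` supp U y"] xy by auto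
  have "op_sum X (mact U f x) (mact U f y) = aact X 2 \<psi> (pair_tuple (mact U f x) (mact U f y))"
    by (rule op_sum_eq [OF \<psi>(1)])
      (use \<psi>(2,3) xy f supp_act_subset [of x f] supp_act_subset [of y f] act_closed [OF f] in auto)
  also have "pair_tuple (mact U f x) (mact U f y) = (\<lambda>i\<in>{1..2}. mact U f (pair_tuple x y i))"
    unfolding pair_tuple_def by (rule restrict_ext) simp
  also have "aact X 2 \<psi> \<dots> = aact X 2 (\<lambda>(i, j)\<in>{1..2} \<times> UNIV. \<psi> (i, f j)) (pair_tuple x y)"
    by (rule op_act_slots [OF \<psi>(1) p f])
  also have "\<dots> = aact X 2 (\<lambda>(i, j)\<in>{1..2} \<times> UNIV. f (\<phi> (i, j))) (pair_tuple x y)"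
  proof (rule op_act_cong [OF inj_op_slots [OF \<psi>(1) f] inj_op_post [OF \<phi>(1) f] p])
    fix i j assume i: "i \<in> {1..2::nat}" and j: "j \<in> supp U (pair_tuple x y i)"
    have "\<phi> (i, j) = j" using \<phi>(2) i j by (simp add: fixes_supports_def)
    moreover have "\<psi> (i, f j) = f j" using i j \<psi>(2,3) unfolding atLeastAtMost_1_2 by auto
    ultimately show "(\<lambda>(i, j)\<in>{1..2} \<times> UNIV. \<psi> (i, f j)) (i, j) = (\<lambda>(i, j)\<in>{1..2} \<times> UNIV. f (\<phi> (i, j))) (i, j)"
      using i by simp
  qed
  also have "\<dots> = mact U f (op_sum X x y)" using act_op_act [OF f \<phi>(1) p] \<phi>(3) by simp
  finally show ?thesis by simp
qed

end

text \<open>The zero is a value on the empty tuple and \<open>x\<close> is the value of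
  \<open>op_unit\<close> on a tuple of length one; joining the two tuples gives that of
  \<open>x\<close> alone.\<close>

lemma op_sum_zero:
  assumes x: "x \<in> acarrier X"
  shows "op_sum X (op_zero X) x = x"
proof -
  have join: "join_tuple 0 1 (\<lambda>_. undefined) (\<lambda>_\<in>{1..1}. x) = (\<lambda>_\<in>{1..1}. x)"
    unfolding join_tuple_def by (auto intro!: restrict_ext)
  have "op_sum X (aact X 0 (\<lambda>_. undefined) (\<lambda>_. undefined)) (aact X 1 op_unit (\<lambda>_\<in>{1..1}. x)) =
      aact X (0 + 1) op_unit (join_tuple 0 1 (\<lambda>_. undefined) (\<lambda>_\<in>{1..1}. x))"
    by (rule op_sum_join)
      (use op_unit_mem fixes_supports_unit single_tuple_mem [OF x] empty_tuple_mem
        in \<open>simp_all add: inj_op_0 fixes_supports_def [of 0]\<close>)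
  then show ?thesis unfolding join op_act_unit [OF x] by (simp add: op_zero_def op_act_unit [OF x, simplified])
qed

text \<open>Both bracketings equal the value on \<open>(x, y, z)\<close> of one ternary operation
  \<open>\<Phi>\<close> that fixes the three supports; they differ only in how this triple is cut
  into two tuples.\<close>

lemma op_sum_assoc:
  assumes mem: "x \<in> acarrier X" "y \<in> acarrier X" "z \<in> acarrier X"
    and disj: "supp U x \<inter> supp U y = {}" "supp U x \<inter> supp U z = {}" "supp U y \<inter> supp U z = {}"
  shows "op_sum X (op_sum X x y) z = op_sum X x (op_sum X y z)"
proof -
  let ?t = "\<lambda>i\<in>{1..3::nat}. if i = 1 then x else if i = 2 then y else z"
  have three: "{1..3} = {1, 2, 3::nat}" by auto
  have join1: "join_tuple 2 1 (pair_tuple x y) (\<lambda>_\<in>{1..1}. z) = ?t"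
    unfolding join_tuple_def pair_tuple_def by (auto intro!: restrict_ext simp: three)
  have join2: "join_tuple 1 2 (\<lambda>_\<in>{1..1}. x) (pair_tuple y z) = ?t"
    unfolding join_tuple_def pair_tuple_def by (auto intro!: restrict_ext simp: three)
  have "finite (supp U (?t i))" if "i \<in> {1..3}" for i
    using that mem by simp
  moreover have "supp U (?t i) \<inter> supp U (?t j) = {}" if "i \<in> {1..3}" "j \<in> {1..3}" "i \<noteq> j" for i j
    using that disj by (auto simp: three)
  ultimately obtain \<Phi> where \<Phi>: "\<Phi> \<in> inj_op 3" "\<And>i j. i \<in> {1..3} \<Longrightarrow> j \<in> supp U (?t i) \<Longrightarrow> \<Phi> (i, j) = j"
    using obtain_fixing_op [of 3 "\<lambda>i. supp U (?t i)"] by blast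
  have fix_t: "fixes_supports 3 \<Phi> ?t" unfolding fixes_supports_def using \<Phi>(2) by blast
  have add: "2 + 1 = (3::nat)" "1 + 2 = (3::nat)" by simp_all
  obtain \<phi> where \<phi>: "\<phi> \<in> inj_op 2" "fixes_supports 2 \<phi> (pair_tuple x y)" "op_sum X x y = aact X 2 \<phi> (pair_tuple x y)"
    using op_sum_witness [OF mem(1,2) disj(1)] .
  obtain \<psi> where \<psi>: "\<psi> \<in> inj_op 2" "fixes_supports 2 \<psi> (pair_tuple y z)" "op_sum X y z = aact X 2 \<psi> (pair_tuple y z)"
    using op_sum_witness [OF mem(2,3) disj(3)] .
  have "op_sum X (aact X 2 \<phi> (pair_tuple x y)) (aact X 1 op_unit (\<lambda>_\<in>{1..1}. z)) =
      aact X (2 + 1) \<Phi> (join_tuple 2 1 (pair_tuple x y) (\<lambda>_\<in>{1..1}. z))"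
    by (rule op_sum_join) (unfold join1 add, (fact \<Phi>(1) \<phi> op_unit_mem fix_t fixes_supports_unit
        pair_tuple_mem [OF mem(1,2)] single_tuple_mem [OF mem(3)])+)
  moreover have "op_sum X (aact X 1 op_unit (\<lambda>_\<in>{1..1}. x)) (aact X 2 \<psi> (pair_tuple y z)) =
      aact X (1 + 2) \<Phi> (join_tuple 1 2 (\<lambda>_\<in>{1..1}. x) (pair_tuple y z))"
    by (rule op_sum_join) (unfold join2 add, (fact \<Phi>(1) \<psi> op_unit_mem fix_t fixes_supports_unit
        pair_tuple_mem [OF mem(2,3)] single_tuple_mem [OF mem(1)])+)
  ultimately show ?thesis unfolding join1 join2 add op_act_unit [OF mem(1)] op_act_unit [OF mem(3)]
    by (simp add: \<phi>(3) \<psi>(3))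
qed

section \<open>The monoid laws and the sum formula for operations\<close>

lemma mult_sum_monoid:
  "(x, y) \<in> box_carrier U U \<Longrightarrow> mult (sum_monoid X) (x, y) = op_sum X x y"
  by (simp add: sum_monoid_def)

lemma base_sum_monoid [simp]: "base (sum_monoid X) = U"
  and neut_sum_monoid [simp]: "neut (sum_monoid X) u = op_zero X"
  by (simp_all add: sum_monoid_def)

lemma supp_op_zero: "supp U (op_zero X) = {}"
  using supp_subset [of "{}" "op_zero X"] by (simp add: supported_on_def act_op_zero)

lemma mem_box_U:
  "(x, y) \<in> box_carrier U U \<longleftrightarrow> x \<in> acarrier X \<and> y \<in> acarrier X \<and> supp U x \<inter> supp U y = {}"
  by (simp add: box_carrier_def)

lemma supp_op_sum:
  assumes xy: "x \<in> acarrier X" "y \<in> acarrier X" "supp U x \<inter> supp U y = {}"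
  shows "supp U (op_sum X x y) \<subseteq> supp U x \<union> supp U y"
proof (rule supp_subset)
  show "supported_on U (op_sum X x y) (supp U x \<union> supp U y)"
    unfolding supported_on_def using xy by (simp add: act_op_sum act_fix)
qed (use xy in simp)

lemma tame_com_monoid_sum_monoid: "is_tame_com_monoid (sum_monoid X)"
  unfolding is_tame_com_monoid_def Let_def base_sum_monoid
proof (intro conjI ballI)
  show "is_tame_M_set U" by (rule tame)
  show "mult (sum_monoid X) \<in> M_hom (U \<boxtimes> U) U"
    unfolding M_hom_def
  proof (intro CollectI conjI ballI)
    show "mult (sum_monoid X) \<in> mcarrier (U \<boxtimes> U) \<rightarrow>\<^sub>E mcarrier U"
      by (auto simp: sum_monoid_def mem_box_U op_sum_closed)
  next
    fix f p assume f: "f \<in> inj_monoid" and p: "p \<in> mcarrier (U \<boxtimes> U)"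
    obtain x y where xy: "p = (x, y)" by force
    have mem: "x \<in> acarrier X" "y \<in> acarrier X" "supp U x \<inter> supp U y = {}"
      using p by (simp_all add: xy mem_box_U)
    have "supp U (mact U f x) \<inter> supp U (mact U f y) \<subseteq> f ` supp U x \<inter> f ` supp U y"
      using supp_act_subset mem f by (intro Int_mono) simp_all
    also have "\<dots> = {}" using f mem(3) image_Int [of f "supp U x" "supp U y"] by simp
    finally show "mult (sum_monoid X) (mact (U \<boxtimes> U) f p) = mact U f (mult (sum_monoid X) p)"
      using f p mem act_closed [unfolded mcarrier_underlying, of f]
      by (simp add: xy act_box mult_sum_monoid act_op_sum mem_box_U)
  qed
  show "neut (sum_monoid X) \<in> M_hom unit_M_set U"
    by (simp add: M_hom_def PiE_iff op_zero_closed act_op_zero act_unit)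
next
  fix p assume p: "p \<in> mcarrier ((U \<boxtimes> U) \<boxtimes> U)"
  obtain x y z where xyz: "p = ((x, y), z)" by (metis surj_pair)
  have xy: "(x, y) \<in> box_carrier U U" and "z \<in> acarrier X" "supp (U \<boxtimes> U) (x, y) \<inter> supp U z = {}"
    using p unfolding xyz mcarrier_box by (simp_all add: box_carrier_def [of "U \<boxtimes> U"])
  then have disj: "supp U x \<inter> supp U z = {}" "supp U y \<inter> supp U z = {}" "supp U x \<inter> supp U y = {}"
    and mem: "x \<in> acarrier X" "y \<in> acarrier X" "z \<in> acarrier X"
    using supp_box [OF tame tame xy] by (auto simp: mem_box_U)
  have "(op_sum X x y, z) \<in> box_carrier U U" "(y, z) \<in> box_carrier U U" "(x, op_sum X y z) \<in> box_carrier U U"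
    using supp_op_sum [of x y] supp_op_sum [of y z] disj mem by (auto simp: mem_box_U op_sum_closed)
  then show "mult (sum_monoid X) (map_prod (mult (sum_monoid X)) id p) =
      mult (sum_monoid X) (map_prod id (mult (sum_monoid X)) (assoc_map p))"
    using xy op_sum_assoc mem disj by (simp add: xyz assoc_map_def mult_sum_monoid)
next
  fix p assume "p \<in> mcarrier (unit_M_set \<boxtimes> U)"
  then have "snd p \<in> acarrier X" by (auto simp: box_carrier_def)
  then show "mult (sum_monoid X) (map_prod (neut (sum_monoid X)) id p) = snd p"
    by (simp add: map_prod_def case_prod_beta mult_sum_monoid mem_box_U op_zero_closed supp_op_zero op_sum_zero)
next
  fix p assume "p \<in> mcarrier (U \<boxtimes> unit_M_set)"
  then have "fst p \<in> acarrier X" by (auto simp: box_carrier_def)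
  then show "mult (sum_monoid X) (map_prod id (neut (sum_monoid X)) p) = fst p"
    using op_sum_commute [of "op_zero X" "fst p"]
    by (simp add: map_prod_def case_prod_beta mult_sum_monoid mem_box_U op_zero_closed supp_op_zero op_sum_zero)
next
  fix p assume p: "p \<in> mcarrier (U \<boxtimes> U)"
  obtain x y where xy: "p = (x, y)" by force
  show "mult (sum_monoid X) (prod.swap p) = mult (sum_monoid X) p"
    using p by (simp add: xy mult_sum_monoid mem_box_U op_sum_commute Int_commute)
qed

sublocale M: tame_com_monoid "sum_monoid X"
  by unfold_locales (rule tame_com_monoid_sum_monoid)

text \<open>Induction on the arity: the last entry is split off as a value of
  \<open>op_unit\<close>, and \<open>op_sum_join\<close> reassembles the tuple from its first
  \<open>n\<close> entries and this one.\<close>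

lemma op_act_fixed_eq_sum:
  "\<phi> \<in> inj_op n \<Longrightarrow> x \<in> tuples X n \<Longrightarrow> fixes_supports n \<phi> x \<Longrightarrow>
    aact X n \<phi> x = monoid_sum (sum_monoid X) {1..n} x"
proof (induction n arbitrary: \<phi> x)
  case 0
  then have "x = (\<lambda>_. undefined)" by (simp add: tuples_def)
  then show ?case using 0 by (simp add: inj_op_0 op_zero_def)
next
  case (Suc n)
  let ?x = "restrict x {1..n}" and ?\<phi> = "restrict \<phi> ({1..n} \<times> UNIV)" and ?y = "\<lambda>_\<in>{1..1}. x (Suc n)"
  have mem: "x i \<in> acarrier X" if "i \<in> {1..Suc n}" for i using tuples_mem [OF Suc.prems(2) that] .
  have x: "?x \<in> tuples X n" unfolding tuples_def using mem by simp
  have y: "?y \<in> tuples X 1" using mem by (intro single_tuple_mem) simp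
  have eq: "\<phi> (i, j) = \<phi> (i', j') \<longleftrightarrow> i = i' \<and> j = j'" if "i \<in> {1..Suc n}" "i' \<in> {1..Suc n}" for i j i' j'
    by (rule inj_op_eq_iff [OF Suc.prems(1) that])
  have fix_x: "\<phi> (i, j) = j" if "i \<in> {1..Suc n}" "j \<in> supp U (x i)" for i j
    using Suc.prems(3) that by (simp add: fixes_supports_def)
  have \<phi>: "?\<phi> \<in> inj_op n" by (rule inj_opI) (use eq in simp)
  have fix_restrict: "fixes_supports n ?\<phi> ?x" using fix_x by (simp add: fixes_supports_def)
  note IH = Suc.IH [OF \<phi> x fix_restrict]
  have join: "join_tuple n 1 ?x ?y = x"
  proof (rule extensionalityI [where A = "{1..Suc n}"])
    show "x \<in> extensional {1..Suc n}" using Suc.prems(2) by (simp add: tuples_def PiE_def)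
    fix i assume i: "i \<in> {1..Suc n}"
    then show "join_tuple n 1 ?x ?y i = x i"
      by (cases "i \<le> n") (auto simp: join_tuple_def le_Suc_eq)
  qed (simp add: join_tuple_def restrict_def extensional_def)
  have ind: "M.independent {1..Suc n} x"
    unfolding M.independent_def base_sum_monoid mcarrier_underlying
  proof (intro conjI ballI impI)
    fix i i' assume i: "i \<in> {1..Suc n}" "i' \<in> {1..Suc n}" "i \<noteq> i'"
    have False if "j \<in> supp U (x i)" "j \<in> supp U (x i')" for j
      using fix_x [OF i(1) that(1)] fix_x [OF i(2) that(2)] eq [OF i(1,2), of j j] i(3) by simp
    then show "supp U (x i) \<inter> supp U (x i') = {}" by blast
  qed (rule mem)
  have Suc_eq: "{1..Suc n} = insert (Suc n) {1..n}" by (simp add: atLeastAtMostSuc_conv)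
  have ind': "M.independent (insert (Suc n) {1..n}) x" "M.independent {1..n} x"
    using ind M.independent_subset [OF ind, of "{1..n}"] unfolding Suc_eq by blast+
  have sum_eq: "monoid_sum (sum_monoid X) {1..n} ?x = monoid_sum (sum_monoid X) {1..n} x"
    by (rule monoid_sum_cong) simp
  have closed: "monoid_sum (sum_monoid X) {1..n} x \<in> acarrier X" "x (Suc n) \<in> acarrier X"
    using M.monoid_sum_closed [OF _ ind'(2)] mem by simp_all
  have disj: "supp U (x (Suc n)) \<inter> supp U (monoid_sum (sum_monoid X) {1..n} x) = {}"
    using M.apart_monoid_sum [OF _ _ ind'(1)] by simp
  have "op_sum X (aact X n ?\<phi> ?x) (aact X 1 op_unit ?y) = aact X (n + 1) \<phi> (join_tuple n 1 ?x ?y)"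
    by (rule op_sum_join [OF _ \<phi> op_unit_mem x y])
      (unfold join Suc_eq_plus1 [symmetric], (fact Suc.prems(1,3) fix_restrict fixes_supports_unit)+)
  then have "aact X (Suc n) \<phi> x = op_sum X (monoid_sum (sum_monoid X) {1..n} x) (x (Suc n))"
    unfolding join IH sum_eq op_act_unit [OF closed(2)] Suc_eq_plus1 [symmetric] by simp
  \<comment> \<open>Joining puts the last entry on the right, while \<open>monoid_sum_insert\<close>
    adds the new term on the left.\<close>
  also have "\<dots> = op_sum X (x (Suc n)) (monoid_sum (sum_monoid X) {1..n} x)"
    by (rule op_sum_commute [OF closed(2,1) disj])
  also have "\<dots> = monoid_sum (sum_monoid X) {1..Suc n} x"
    unfolding Suc_eq using M.monoid_sum_insert [OF _ _ ind'(1)] closed disj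
    by (simp add: mult_sum_monoid mem_box_U)
  finally show ?case .
qed

text \<open>\<open>\<phi>\<close> itself need not fix any support. On the supports it agrees with
  its slots followed by an operation \<open>\<psi>\<close> that fixes all their values there. The
  slots move into the entries, and \<open>\<psi>\<close> fixes the supports of the moved entries, so
  the previous case applies.\<close>

lemma op_act_eq_sum:
  assumes \<phi>: "\<phi> \<in> inj_op n" and x: "x \<in> tuples X n"
  shows "aact X n \<phi> x = monoid_sum (sum_monoid X) {1..n} (\<lambda>i. mact U (\<lambda>j. \<phi> (i, j)) (x i))"
proof -
  let ?y = "\<lambda>i\<in>{1..n}. mact U (\<lambda>j. \<phi> (i, j)) (x i)"
  let ?A = "\<lambda>i. (\<lambda>j. \<phi> (i, j)) ` supp U (x i)"
  have mem: "x i \<in> acarrier X" if "i \<in> {1..n}" for i using tuples_mem [OF x that] .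
  have slot: "inj (\<lambda>j. \<phi> (i, j))" if "i \<in> {1..n}" for i using inj_op_slot [OF \<phi> that] .
  have y: "?y \<in> tuples X n" unfolding tuples_def using act_closed [OF slot] mem by simp
  have "?A i \<inter> ?A i' = {}" if "i \<in> {1..n}" "i' \<in> {1..n}" "i \<noteq> i'" for i i'
    using inj_op_eq_iff [OF \<phi> that(1,2)] that(3) by blast
  moreover have "finite (?A i)" if "i \<in> {1..n}" for i using mem [OF that] by simp
  ultimately obtain \<psi> where \<psi>: "\<psi> \<in> inj_op n" "\<And>i j. i \<in> {1..n} \<Longrightarrow> j \<in> ?A i \<Longrightarrow> \<psi> (i, j) = j"
    using obtain_fixing_op [of n ?A] by blast
  have "aact X n \<phi> x = aact X n (\<lambda>(i, j)\<in>{1..n} \<times> UNIV. \<psi> (i, \<phi> (i, j))) x"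
    by (rule op_act_cong [OF \<phi> inj_op_slots [where f = "\<lambda>i j. \<phi> (i, j)", OF \<psi>(1) slot] x]) (simp_all add: \<psi>(2))
  also have "\<dots> = aact X n \<psi> ?y"
    by (rule op_act_slots [where f = "\<lambda>i j. \<phi> (i, j)", OF \<psi>(1) x slot, symmetric])
  also have "\<dots> = monoid_sum (sum_monoid X) {1..n} ?y"
  proof (rule op_act_fixed_eq_sum [OF \<psi>(1) y])
    show "fixes_supports n \<psi> ?y"
      unfolding fixes_supports_def
    proof (intro ballI)
      fix i j assume i: "i \<in> {1..n}" and "j \<in> supp U (?y i)"
      then have "j \<in> ?A i" using supp_act_subset [OF _ slot [OF i], of "x i"] mem [OF i] by auto
      then show "\<psi> (i, j) = j" by (rule \<psi>(2) [OF i])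
    qed
  qed
  also have "\<dots> = monoid_sum (sum_monoid X) {1..n} (\<lambda>i. mact U (\<lambda>j. \<phi> (i, j)) (x i))"
    by (rule monoid_sum_cong) simp
  finally show ?thesis .
qed

end


section \<open>The algebra of a commutative monoid\<close>

text \<open>The restrictions make \<open>aact\<close> extensional in the operation and in the tuple,
  so that the two passages between algebras and monoids can be inverse as equalities of
  records.\<close>

definition op_set_of :: "'a M_monoid \<Rightarrow> 'a op_set" where
  "op_set_of R = \<lparr>acarrier = mcarrier (base R),
     aact = (\<lambda>n. \<lambda>\<phi>\<in>inj_op n. \<lambda>x\<in>{1..n} \<rightarrow>\<^sub>E mcarrier (base R).
       monoid_sum R {1..n} (\<lambda>i. mact (base R) (\<lambda>j. \<phi> (i, j)) (x i)))\<rparr>"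

lemma acarrier_op_set_of [simp]: "acarrier (op_set_of R) = mcarrier (base R)"
  by (simp add: op_set_of_def)

lemma aact_op_set_of:
  "\<phi> \<in> inj_op n \<Longrightarrow> x \<in> tuples (op_set_of R) n \<Longrightarrow>
    aact (op_set_of R) n \<phi> x = monoid_sum R {1..n} (\<lambda>i. mact (base R) (\<lambda>j. \<phi> (i, j)) (x i))"
  by (simp add: op_set_of_def tuples_def)

text \<open>Together with the next lemma, this makes
  \<open>(m, p) \<mapsto> sum ns {1..<m} + p\<close> a bijection onto the positions, with
  \<open>block\<close> and \<open>block_pos\<close> as its inverse. It replaces the definite
  description by explicit coordinates.\<close>

lemma block_exists:
  fixes ns :: "nat \<Rightarrow> nat"
  shows "i \<in> {1..sum ns {1..k}} \<Longrightarrow> \<exists>m\<in>{1..k}. \<exists>p\<in>{1..ns m}. i = sum ns {1..<m} + p"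
proof (induction k)
  case (Suc k)
  have split: "sum ns {1..Suc k} = sum ns {1..k} + ns (Suc k)" by simp
  show ?case
  proof (cases "i \<le> sum ns {1..k}")
    case True
    then show ?thesis using Suc by fastforce
  next
    case False
    then have "i - sum ns {1..k} \<in> {1..ns (Suc k)}" "i = sum ns {1..<Suc k} + (i - sum ns {1..k})"
      using Suc.prems split by (auto simp: atLeastLessThanSuc_atLeastAtMost)
    then show ?thesis by fastforce
  qed
qed simp

lemma
  assumes "m \<in> {1..k}" "p \<in> {1..ns m}"
  shows block_offset: "block k ns (sum ns {1..<m} + p) = m"
    and block_pos_offset: "block_pos k ns (sum ns {1..<m} + p) = p"
    and offset_mem: "sum ns {1..<m} + p \<in> {1..sum ns {1..k}}"
proof -
  have "sum ns {1..m} = sum ns {1..<m} + ns m"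
    using assms(1) by (cases m) (auto simp: atLeastLessThanSuc_atLeastAtMost)
  then have le: "sum ns {1..<m} + p \<le> sum ns {1..m}" using assms(2) by simp
  show b: "block k ns (sum ns {1..<m} + p) = m"
    by (rule block_eq [OF assms(1)]) (use assms(2) le in auto)
  then show "block_pos k ns (sum ns {1..<m} + p) = p" by (simp add: block_pos_def)
  have "sum ns {1..m} \<le> sum ns {1..k}" using assms(1) by (intro sum_mono2) auto
  then show "sum ns {1..<m} + p \<in> {1..sum ns {1..k}}" using le assms(2) by simp
qed

lemma op_comp_mem:
  assumes \<phi>: "\<phi> \<in> inj_op k" and \<psi>: "\<And>m. m \<in> {1..k} \<Longrightarrow> \<psi> m \<in> inj_op (ns m)"
  shows "op_comp k ns \<phi> \<psi> \<in> inj_op (sum ns {1..k})"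
  unfolding op_comp_def
proof (rule inj_opI)
  fix i j i' j'
  assume i: "i \<in> {1..sum ns {1..k}}" "i' \<in> {1..sum ns {1..k}}"
    and "(case (i, j) of (i, j) \<Rightarrow> \<phi> (block k ns i, \<psi> (block k ns i) (block_pos k ns i, j))) =
      (case (i', j') of (i, j) \<Rightarrow> \<phi> (block k ns i, \<psi> (block k ns i) (block_pos k ns i, j)))"
  then have eq: "\<phi> (block k ns i, \<psi> (block k ns i) (block_pos k ns i, j)) =
      \<phi> (block k ns i', \<psi> (block k ns i') (block_pos k ns i', j'))" by simp
  obtain m p where mp: "m \<in> {1..k}" "p \<in> {1..ns m}" "i = sum ns {1..<m} + p"
    using block_exists [OF i(1)] by blast
  obtain m' p' where mp': "m' \<in> {1..k}" "p' \<in> {1..ns m'}" "i' = sum ns {1..<m'} + p'"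
    using block_exists [OF i(2)] by blast
  have "\<phi> (m, \<psi> m (p, j)) = \<phi> (m', \<psi> m' (p', j'))"
    using eq unfolding mp(3) mp'(3) block_offset [where ns = ns, OF mp(1,2)] block_offset [where ns = ns, OF mp'(1,2)]
      block_pos_offset [where ns = ns, OF mp(1,2)] block_pos_offset [where ns = ns, OF mp'(1,2)] .
  then have m: "m = m'" and "\<psi> m (p, j) = \<psi> m' (p', j')" using inj_op_eq_iff [OF \<phi> mp(1) mp'(1)] by blast+
  then have "p = p' \<and> j = j'" using inj_op_eq_iff [OF \<psi> [OF mp(1)] mp(2)] mp'(2) by blast
  then show "i = i' \<and> j = j'" using m mp(3) mp'(3) by simp
qed

context tame_com_monoid
begin

lemma independent_slots:
  assumes "\<phi> \<in> inj_op n" "\<And>i. i \<in> {1..n} \<Longrightarrow> x i \<in> C"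
  shows "independent {1..n} (\<lambda>i. mact B (\<lambda>j. \<phi> (i, j)) (x i))"
  unfolding independent_def
proof (intro conjI ballI impI)
  fix i assume "i \<in> {1..n}"
  then show "mact B (\<lambda>j. \<phi> (i, j)) (x i) \<in> C" by (intro act_closed inj_op_slot [OF assms(1)] assms(2))
next
  fix i i' assume "i \<in> {1..n}" "i' \<in> {1..n}" "i \<noteq> i'"
  then show "apart (mact B (\<lambda>j. \<phi> (i, j)) (x i)) (mact B (\<lambda>j. \<phi> (i', j)) (x i'))"
    by (intro supp_slots_disjoint [OF assms(1)] assms(2))
qed

text \<open>Generalised associativity in the form that the operad composition asks for. The last
  block is peeled off; the sum over its positions is the inner sum after a shift of the
  index.\<close>

lemma monoid_sum_blocks:
  "independent {1..sum ns {1..k}} y \<Longrightarrow>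
    monoid_sum R {1..sum ns {1..k}} y =
    monoid_sum R {1..k} (\<lambda>m. monoid_sum R {1..ns m} (\<lambda>p. y (sum ns {1..<m} + p)))"
proof (induction k)
  case (Suc k)
  let ?N = "sum ns {1..k}"
  let ?z = "\<lambda>m. monoid_sum R {1..ns m} (\<lambda>p. y (sum ns {1..<m} + p))"
  let ?J = "\<lambda>m. (\<lambda>p. sum ns {1..<m} + p) ` {1..ns m}"
  have z: "?z m = monoid_sum R (?J m) y" "independent (?J m) y" if "m \<in> {1..Suc k}" for m
  proof -
    show ind: "independent (?J m) y"
      by (rule independent_subset [OF Suc.prems]) (use offset_mem [where ns = ns, OF that] in blast)
    show "?z m = monoid_sum R (?J m) y" by (rule monoid_sum_image [symmetric, OF _ _ ind]) simp_all
  qed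
  have ind: "independent {1..Suc k} ?z"
    unfolding independent_def
  proof (intro conjI ballI impI)
    fix m assume m: "m \<in> {1..Suc k}"
    show "?z m \<in> C" unfolding z(1) [OF m] by (rule monoid_sum_closed [OF _ z(2) [OF m]]) simp
  next
    fix m m' assume m: "m \<in> {1..Suc k}" "m' \<in> {1..Suc k}" "m \<noteq> m'"
    \<comment> \<open>\<open>block\<close> recovers \<open>m\<close> from \<open>i\<close> and
      \<open>m'\<close> from \<open>i'\<close>, so these are different positions; thus the inner
      sums have disjoint supports and can be added.\<close>
    have "apart (y i) (y i')" if i: "i \<in> ?J m" "i' \<in> ?J m'" for i i'
    proof -
      have "i \<in> {1..sum ns {1..Suc k}}" "i' \<in> {1..sum ns {1..Suc k}}"
        using i offset_mem [where ns = ns, OF m(1)] offset_mem [where ns = ns, OF m(2)] by blast+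
      moreover have "block (Suc k) ns i = m" "block (Suc k) ns i' = m'"
        using i block_offset [where ns = ns, OF m(1)] block_offset [where ns = ns, OF m(2)] by blast+
      then have "i \<noteq> i'" using m(3) by blast
      ultimately show ?thesis using Suc.prems unfolding independent_def by blast
    qed
    then show "apart (?z m) (?z m')"
      unfolding z(1) [OF m(1)] z(1) [OF m(2)]
      using supp_monoid_sum [OF _ z(2) [OF m(1)]] supp_monoid_sum [OF _ z(2) [OF m(2)]] by blast
  qed
  have J: "{1..sum ns {1..Suc k}} = ?J (Suc k) \<union> {1..?N}"
    by (auto simp: atLeastLessThanSuc_atLeastAtMost image_add_atLeastAtMost)
  have disj: "?J (Suc k) \<inter> {1..?N} = {}" by (auto simp: atLeastLessThanSuc_atLeastAtMost)
  have indN: "independent {1..?N} y" using independent_subset [OF Suc.prems] J by blast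
  have "monoid_sum R {1..sum ns {1..Suc k}} y = monoid_sum R (?J (Suc k)) y \<oplus> monoid_sum R {1..?N} y"
    unfolding J by (rule monoid_sum_Un) (use disj Suc.prems [unfolded J] in simp_all)
  also have "\<dots> = ?z (Suc k) \<oplus> monoid_sum R {1..k} ?z"
    unfolding Suc.IH [OF indN] using z(1) [of "Suc k"] by simp
  also have "\<dots> = monoid_sum R (insert (Suc k) {1..k}) ?z"
    by (rule monoid_sum_insert [symmetric]) (use ind in \<open>simp_all add: atLeastAtMostSuc_conv\<close>)
  finally show ?case by (simp add: atLeastAtMostSuc_conv)
qed simp

lemma op_set_of_closed:
  assumes "\<phi> \<in> inj_op n" "x \<in> tuples (op_set_of R) n"
  shows "aact (op_set_of R) n \<phi> x \<in> C"
  unfolding aact_op_set_of [OF assms]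
  by (rule monoid_sum_closed [OF _ independent_slots [OF assms(1)]]) (use assms(2) in \<open>auto simp: tuples_def\<close>)

lemma is_op_set_op_set_of: "is_op_set (op_set_of R)"
  unfolding is_op_set_def
proof (intro conjI allI ballI impI)
  fix n
  show "aact (op_set_of R) n \<in> inj_op n \<rightarrow>\<^sub>E tuples (op_set_of R) n \<rightarrow>\<^sub>E acarrier (op_set_of R)"
  proof (intro PiE_I)
    fix \<phi> x assume "\<phi> \<in> inj_op n" "x \<in> tuples (op_set_of R) n"
    then show "aact (op_set_of R) n \<phi> x \<in> acarrier (op_set_of R)" using op_set_of_closed by simp
  qed (simp_all add: op_set_of_def tuples_def)
next
  fix x assume x: "x \<in> tuples (op_set_of R) 1"
  then have "x 1 \<in> C" by (auto simp: tuples_def)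
  moreover have "(\<lambda>j. op_unit (1, j)) = id" by (auto simp: op_unit_def)
  ultimately show "aact (op_set_of R) 1 op_unit x = x 1"
    unfolding aact_op_set_of [OF op_unit_mem x] by (simp add: monoid_sum_singleton)
next
  fix k ns \<phi> \<psi> x
  assume \<phi>: "\<phi> \<in> inj_op k" and \<psi>_all: "\<forall>m\<in>{1..k}. \<psi> m \<in> inj_op (ns m)"
    and x_all: "\<forall>m\<in>{1..k}. x m \<in> tuples (op_set_of R) (ns m)"
  let ?N = "sum ns {1..k}" and ?\<chi> = "op_comp k ns \<phi> \<psi>" and ?x = "tuple_concat k ns x"
  let ?y = "\<lambda>i. mact B (\<lambda>j. ?\<chi> (i, j)) (?x i)"
  let ?w = "\<lambda>m. monoid_sum R {1..ns m} (\<lambda>p. mact B (\<lambda>j. \<psi> m (p, j)) (x m p))"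
  have \<psi>: "\<psi> m \<in> inj_op (ns m)" and x: "x m \<in> tuples (op_set_of R) (ns m)" if "m \<in> {1..k}" for m
    using that \<psi>_all x_all by blast+
  have xm: "x m p \<in> C" if "m \<in> {1..k}" "p \<in> {1..ns m}" for m p
    using PiE_mem [OF x [OF that(1), unfolded tuples_def] that(2)] by simp
  have \<chi>: "?\<chi> \<in> inj_op ?N" by (rule op_comp_mem [OF \<phi> \<psi>])
  have x_offset: "?x (sum ns {1..<m} + p) = x m p" if "m \<in> {1..k}" "p \<in> {1..ns m}" for m p
    unfolding tuple_concat_def restrict_apply'[OF offset_mem [where ns = ns, OF that]]
      block_offset [where ns = ns, OF that] block_pos_offset [where ns = ns, OF that] ..
  have x_mem: "?x i \<in> C" if i: "i \<in> {1..?N}" for i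
  proof -
    obtain m p where mp: "m \<in> {1..k}" "p \<in> {1..ns m}" "i = sum ns {1..<m} + p"
      using block_exists [OF i] by blast
    then show ?thesis using x_offset xm by simp
  qed
  then have x_tuple: "?x \<in> tuples (op_set_of R) ?N"
    by (simp add: tuples_def PiE_iff tuple_concat_def)
  \<comment> \<open>In block coordinates the slot of the composite is slot \<open>m\<close> of
    \<open>\<phi>\<close> after slot \<open>p\<close> of \<open>\<psi> m\<close>. Regrouping by
    blocks and pulling the action of \<open>\<phi>\<close> out of each inner sum then gives the
    associativity axiom.\<close>
  have y_offset: "?y (sum ns {1..<m} + p) = mact B (\<lambda>j. \<phi> (m, j)) (mact B (\<lambda>j. \<psi> m (p, j)) (x m p))"
    if mp: "m \<in> {1..k}" "p \<in> {1..ns m}" for m p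
  proof -
    have "(\<lambda>j. ?\<chi> (sum ns {1..<m} + p, j)) = (\<lambda>j. \<phi> (m, \<psi> m (p, j)))"
      unfolding op_comp_def using offset_mem [where ns = ns, OF mp] block_offset [where ns = ns, OF mp] block_pos_offset [where ns = ns, OF mp] by auto
    then show ?thesis
      unfolding x_offset [OF mp] using act_comp [OF inj_op_slot [OF \<phi> mp(1)] inj_op_slot [OF \<psi> [OF mp(1)] mp(2)] xm [OF mp]]
      by simp
  qed
  have w: "?w m \<in> C" "independent {1..ns m} (\<lambda>p. mact B (\<lambda>j. \<psi> m (p, j)) (x m p))" if m: "m \<in> {1..k}" for m
  proof -
    show ind: "independent {1..ns m} (\<lambda>p. mact B (\<lambda>j. \<psi> m (p, j)) (x m p))"
      by (rule independent_slots [OF \<psi> [OF m] xm [OF m]])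
    show "?w m \<in> C" by (rule monoid_sum_closed [OF _ ind]) simp
  qed
  have "aact (op_set_of R) ?N ?\<chi> ?x = monoid_sum R {1..?N} ?y"
    by (rule aact_op_set_of [OF \<chi> x_tuple])
  also have "\<dots> = monoid_sum R {1..k} (\<lambda>m. monoid_sum R {1..ns m} (\<lambda>p. ?y (sum ns {1..<m} + p)))"
    by (rule monoid_sum_blocks [OF independent_slots [OF \<chi> x_mem]])
  also have "\<dots> = monoid_sum R {1..k} (\<lambda>m. mact B (\<lambda>j. \<phi> (m, j)) (?w m))"
  proof (rule monoid_sum_cong)
    fix m assume m: "m \<in> {1..k}"
    have "monoid_sum R {1..ns m} (\<lambda>p. ?y (sum ns {1..<m} + p)) =
        monoid_sum R {1..ns m} (\<lambda>p. mact B (\<lambda>j. \<phi> (m, j)) (mact B (\<lambda>j. \<psi> m (p, j)) (x m p)))"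
      by (rule monoid_sum_cong) (rule y_offset [OF m])
    also have "\<dots> = mact B (\<lambda>j. \<phi> (m, j)) (?w m)"
      by (rule act_monoid_sum [symmetric, OF inj_op_slot [OF \<phi> m] _ w(2) [OF m]]) simp
    finally show "monoid_sum R {1..ns m} (\<lambda>p. ?y (sum ns {1..<m} + p)) = mact B (\<lambda>j. \<phi> (m, j)) (?w m)" .
  qed
  also have "\<dots> = monoid_sum R {1..k} (\<lambda>m. mact B (\<lambda>j. \<phi> (m, j)) ((\<lambda>m\<in>{1..k}. aact (op_set_of R) (ns m) (\<psi> m) (x m)) m))"
    by (rule monoid_sum_cong) (simp add: aact_op_set_of [OF \<psi> x])
  also have "\<dots> = aact (op_set_of R) k \<phi> (\<lambda>m\<in>{1..k}. aact (op_set_of R) (ns m) (\<psi> m) (x m))"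
    by (rule aact_op_set_of [symmetric, OF \<phi>])
      (unfold tuples_def restrict_PiE_iff, simp add: op_set_of_closed [OF \<psi> x])
  finally show "aact (op_set_of R) ?N ?\<chi> ?x =
    aact (op_set_of R) k \<phi> (\<lambda>m\<in>{1..k}. aact (op_set_of R) (ns m) (\<psi> m) (x m))" .
next
  fix n \<phi> \<sigma> x
  assume \<phi>: "\<phi> \<in> inj_op n" and \<sigma>: "\<sigma> permutes {1..n}" and x: "x \<in> tuples (op_set_of R) n"
  let ?x = "\<lambda>i\<in>{1..n}. x (inv \<sigma> i)"
  let ?y = "\<lambda>i. mact B (\<lambda>j. \<phi> (i, j)) (?x i)"
  have inv_mem: "inv \<sigma> i \<in> {1..n}" if "i \<in> {1..n}" for i
    using permutes_in_image [OF permutes_inv [OF \<sigma>]] that by blast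
  have \<sigma>_mem: "\<sigma> i \<in> {1..n}" if "i \<in> {1..n}" for i using permutes_in_image [OF \<sigma>] that by blast
  have mem: "x i \<in> C" if "i \<in> {1..n}" for i using PiE_mem [OF x [unfolded tuples_def] that] by simp
  have x': "?x \<in> tuples (op_set_of R) n"
    unfolding tuples_def using mem inv_mem by (intro restrict_PiE_iff [THEN iffD2] ballI) simp
  have ind: "independent {1..n} ?y"
    by (rule independent_slots [OF \<phi>]) (use mem inv_mem in simp)
  have "aact (op_set_of R) n (op_perm n \<phi> \<sigma>) x =
      monoid_sum R {1..n} (\<lambda>i. mact B (\<lambda>j. op_perm n \<phi> \<sigma> (i, j)) (x i))"
    by (rule aact_op_set_of [OF op_perm_mem [OF \<phi> \<sigma>] x])
  \<comment> \<open>Slot \<open>i\<close> of the permuted operation is slot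
    \<open>\<sigma> i\<close> of \<open>\<phi>\<close>, and \<open>x i\<close> is the entry at
    \<open>\<sigma> i\<close> of the permuted tuple. The two sums have the same terms, reindexed
    along \<open>\<sigma>\<close>.\<close>
  also have "\<dots> = monoid_sum R {1..n} (\<lambda>i. ?y (\<sigma> i))"
  proof (rule monoid_sum_cong)
    fix i assume i: "i \<in> {1..n}"
    have "(\<lambda>j. op_perm n \<phi> \<sigma> (i, j)) = (\<lambda>j. \<phi> (\<sigma> i, j))" using i by (simp add: op_perm_def)
    moreover have "?x (\<sigma> i) = x i" using \<sigma>_mem [OF i] permutes_inverses(2) [OF \<sigma>] by simp
    ultimately show "mact B (\<lambda>j. op_perm n \<phi> \<sigma> (i, j)) (x i) = ?y (\<sigma> i)" by simp
  qed
  also have "\<dots> = monoid_sum R (\<sigma> ` {1..n}) ?y"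
    by (rule monoid_sum_image [symmetric])
      (use ind permutes_image [OF \<sigma>] permutes_inj_on [OF \<sigma>] in simp_all)
  also have "\<dots> = aact (op_set_of R) n \<phi> ?x"
    unfolding permutes_image [OF \<sigma>] by (rule aact_op_set_of [symmetric, OF \<phi> x'])
  finally show "aact (op_set_of R) n (op_perm n \<phi> \<sigma>) x = aact (op_set_of R) n \<phi> ?x" .
qed

text \<open>A unary operation yields a sum with one term, which is the original action. Equality of
  the records also uses that both actions are extensional in the injection and in the
  element.\<close>

lemma underlying_op_set_of [simp]: "underlying (op_set_of R) = B"
proof -
  have "is_M_set B" using tame by (simp add: is_tame_M_set_def)
  then have B: "mact B \<in> inj_monoid \<rightarrow>\<^sub>E C \<rightarrow>\<^sub>E C" by (simp add: is_M_set_def)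
  have "(\<lambda>f\<in>inj_monoid. \<lambda>x\<in>C. aact (op_set_of R) 1 (op_of_inj f) (\<lambda>i\<in>{1..1}. x)) = mact B"
  proof (rule extensionalityI [where A = inj_monoid])
    fix f assume f: "f \<in> inj_monoid"
    show "(\<lambda>f\<in>inj_monoid. \<lambda>x\<in>C. aact (op_set_of R) 1 (op_of_inj f) (\<lambda>i\<in>{1..1}. x)) f = mact B f"
      unfolding restrict_apply' [OF f]
    proof (rule extensionalityI [where A = C])
      fix x assume x: "x \<in> C"
      have "(\<lambda>i\<in>{1..1}. x) \<in> tuples (op_set_of R) 1" using x by (simp add: tuples_def)
      note eq = aact_op_set_of [OF op_of_inj_mem this]
      have "(\<lambda>j. op_of_inj f (1, j)) = f" by (simp add: op_of_inj_def)
      then show "(\<lambda>x\<in>C. aact (op_set_of R) 1 (op_of_inj f) (\<lambda>i\<in>{1..1}. x)) x = mact B f x"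
        using f x by (simp add: eq [simplified] monoid_sum_singleton)
    qed (use PiE_mem [OF B f] in \<open>auto simp: PiE_def\<close>)
  qed (use B in \<open>auto simp: PiE_def\<close>)
  then show ?thesis by (simp add: underlying_def)
qed

lemma is_tame_op_set_of: "is_tame_op_set (op_set_of R)"
  by (simp add: is_tame_op_set_def is_op_set_op_set_of tame)

text \<open>The slots of an admissible \<open>\<phi>\<close> fix the supports of \<open>x\<close>
  and \<open>y\<close> and so act trivially on them; what remains of the formula is the sum of two
  terms. The nullary operation gives the empty sum, the neutral element.\<close>

lemma sum_monoid_op_set_of: "sum_monoid (op_set_of R) = R"
proof -
  interpret A: tame_op_set "op_set_of R" by unfold_locales (rule is_tame_op_set_of)
  have "op_sum (op_set_of R) x y = mult R (x, y)" if xy: "(x, y) \<in> box_carrier B B" for x y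
  proof -
    have mem: "x \<in> C" "y \<in> C" "apart x y" using xy by (simp_all add: box_carrier_def)
    obtain \<phi> where \<phi>: "\<phi> \<in> inj_op 2" "\<And>j. j \<in> supp B x \<Longrightarrow> \<phi> (1, j) = j" "\<And>j. j \<in> supp B y \<Longrightarrow> \<phi> (2, j) = j"
      using obtain_fixing_op_pair [of "supp B x" "supp B y"] mem by auto
    have p: "pair_tuple x y \<in> tuples (op_set_of R) 2" by (rule A.pair_tuple_mem) (use mem in simp_all)
    let ?y = "\<lambda>i. mact B (\<lambda>j. \<phi> (i, j)) (pair_tuple x y i)"
    have fix_x: "mact B (\<lambda>j. \<phi> (1, j)) x = x"
      by (rule act_fix [OF mem(1) inj_op_slot [OF \<phi>(1)] \<phi>(2)]) simp_all
    have fix_y: "mact B (\<lambda>j. \<phi> (2, j)) y = y"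
      by (rule act_fix [OF mem(2) inj_op_slot [OF \<phi>(1)] \<phi>(3)]) simp_all
    have "op_sum (op_set_of R) x y = aact (op_set_of R) 2 \<phi> (pair_tuple x y)"
      by (rule A.op_sum_eq) (use \<phi> mem in simp_all)
    also have "\<dots> = monoid_sum R {1..2} ?y" by (rule aact_op_set_of [OF \<phi>(1) p])
    also have "\<dots> = ?y 1 \<oplus> monoid_sum R {2} ?y"
      unfolding atLeastAtMost_1_2
      by (rule monoid_sum_insert) (simp_all add: independent_def fix_x fix_y mem Int_commute)
    also have "\<dots> = x \<oplus> y" using mem by (simp add: fix_x fix_y monoid_sum_singleton)
    finally show ?thesis .
  qed
  then have "(\<lambda>(x, y)\<in>box_carrier B B. op_sum (op_set_of R) x y) = mult R"
    using mult_hom unfolding M_hom_def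
    by (intro extensionalityI [where A = "box_carrier B B"]) (auto simp: PiE_def)
  moreover have "(\<lambda>_. op_zero (op_set_of R)) = neut R"
    by (simp add: fun_eq_iff op_zero_def aact_op_set_of inj_op_0 A.empty_tuple_mem)
  ultimately show ?thesis by (simp add: sum_monoid_def)
qed

end

lemma (in tame_op_set) op_set_of_sum_monoid: "op_set_of (sum_monoid X) = X"
proof -
  have tuples: "tuples (op_set_of (sum_monoid X)) n = tuples X n" for n by (simp add: tuples_def)
  have "aact (op_set_of (sum_monoid X)) n = aact X n" for n
  proof (rule extensionalityI [where A = "inj_op n"])
    fix \<phi> assume \<phi>: "\<phi> \<in> inj_op n"
    show "aact (op_set_of (sum_monoid X)) n \<phi> = aact X n \<phi>"
    proof (rule extensionalityI [where A = "tuples X n"])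
      fix x assume x: "x \<in> tuples X n"
      show "aact (op_set_of (sum_monoid X)) n \<phi> x = aact X n \<phi> x"
        using aact_op_set_of [of \<phi> n x "sum_monoid X"] op_act_eq_sum [OF \<phi> x] \<phi> x tuples by simp
    qed (use PiE_mem [OF op_act_PiE \<phi>] \<phi> in \<open>auto simp: PiE_def op_set_of_def tuples_def\<close>)
  qed (use op_act_PiE [of n] in \<open>auto simp: PiE_def op_set_of_def\<close>)
  then have "aact (op_set_of (sum_monoid X)) = aact X" ..
  moreover have "acarrier (op_set_of (sum_monoid X)) = acarrier X" by simp
  ultimately show ?thesis by (intro op_set.equality) simp_all
qed


section \<open>Morphisms\<close>

text \<open>Since \<open>h\<close> is equivariant, it can only shrink supports. An operation
  admissible for \<open>(x, y)\<close> is thus admissible for \<open>(h x, h y)\<close>, and the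
  same \<open>\<phi>\<close> computes both sums.\<close>

lemma op_set_hom_imp_com_monoid_hom:
  assumes "is_tame_op_set X" "is_tame_op_set Y" and h: "h \<in> op_set_hom X Y"
  shows "h \<in> com_monoid_hom (sum_monoid X) (sum_monoid Y)"
proof -
  interpret X: tame_op_set X by unfold_locales fact
  interpret Y: tame_op_set Y by unfold_locales fact
  have h_fun: "h \<in> acarrier X \<rightarrow>\<^sub>E acarrier Y" using h by (simp add: op_set_hom_def)
  have h_mem: "h x \<in> acarrier Y" if "x \<in> acarrier X" for x using PiE_mem [OF h_fun that] .
  have h_act: "h (aact X n \<phi> x) = aact Y n \<phi> (\<lambda>i\<in>{1..n}. h (x i))" if "\<phi> \<in> inj_op n" "x \<in> tuples X n" for n \<phi> x
    using h that by (simp add: op_set_hom_def)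
  have "h (mact X.U f x) = mact Y.U f (h x)" if f: "inj f" and x: "x \<in> acarrier X" for f x
  proof -
    have "(\<lambda>i\<in>{1..1}. h ((\<lambda>_\<in>{1..1}. x) i)) = (\<lambda>_\<in>{1..1::nat}. h x)" by (rule restrict_ext) simp
    then show ?thesis
      using h_act [OF op_of_inj_mem [OF f] X.single_tuple_mem [OF x]]
      unfolding X.act_underlying [OF f x] Y.act_underlying [OF f h_mem [OF x]] by simp
  qed
  then have h_M: "h \<in> M_hom X.U Y.U" using h_fun by (simp add: M_hom_def)
  have h_supp: "supp Y.U (h x) \<subseteq> supp X.U x" if "x \<in> acarrier X" for x
    using supp_hom_subset [OF X.tame Y.tame h_M] that by simp
  have h_sum: "h (mult (sum_monoid X) p) = mult (sum_monoid Y) (map_prod h h p)" if "p \<in> box_carrier X.U X.U" for p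
  proof -
    obtain x y where p: "p = (x, y)" by force
    have xy: "x \<in> acarrier X" "y \<in> acarrier X" "supp X.U x \<inter> supp X.U y = {}"
      using that by (simp_all add: p X.mem_box_U)
    have "supp Y.U (h x) \<inter> supp Y.U (h y) = {}" using xy(3) h_supp [OF xy(1)] h_supp [OF xy(2)] by blast
    then have box: "(h x, h y) \<in> box_carrier Y.U Y.U" using xy h_mem by (simp add: Y.mem_box_U)
    obtain \<phi> where \<phi>: "\<phi> \<in> inj_op 2" "\<And>j. j \<in> supp X.U x \<Longrightarrow> \<phi> (1, j) = j" "\<And>j. j \<in> supp X.U y \<Longrightarrow> \<phi> (2, j) = j"
      using obtain_fixing_op_pair [of "supp X.U x" "supp X.U y"] xy by auto
    have "h (op_sum X x y) = h (aact X 2 \<phi> (pair_tuple x y))"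
      using X.op_sum_eq [OF \<phi>(1) xy(1,2)] \<phi>(2,3) by simp
    also have "\<dots> = aact Y 2 \<phi> (\<lambda>i\<in>{1..2}. h (pair_tuple x y i))"
      by (rule h_act [OF \<phi>(1) X.pair_tuple_mem [OF xy(1,2)]])
    also have "(\<lambda>i\<in>{1..2}. h (pair_tuple x y i)) = pair_tuple (h x) (h y)"
      unfolding pair_tuple_def by (rule restrict_ext) simp
    also have "aact Y 2 \<phi> (pair_tuple (h x) (h y)) = op_sum Y (h x) (h y)"
      by (rule Y.op_sum_eq [symmetric, OF \<phi>(1)]) (use \<phi>(2,3) xy h_mem h_supp in blast)+
    finally show ?thesis using that box by (simp add: p X.mult_sum_monoid Y.mult_sum_monoid)
  qed
  have "h (op_zero X) = op_zero Y"
    unfolding op_zero_def using h_act [of "\<lambda>_. undefined" 0 "\<lambda>_. undefined"]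
    by (simp add: inj_op_0 X.empty_tuple_mem restrict_def)
  then show ?thesis using h_M h_sum by (simp add: com_monoid_hom_def)
qed

text \<open>In algebras of the form \<open>op_set_of\<close> an operation is a sum of translates of
  the entries, and \<open>h\<close> commutes with the action and with such sums.\<close>

lemma com_monoid_hom_imp_op_set_hom:
  assumes R: "is_tame_com_monoid R" and S: "is_tame_com_monoid S" and h: "h \<in> com_monoid_hom R S"
  shows "h \<in> op_set_hom (op_set_of R) (op_set_of S)"
proof -
  interpret R: tame_com_monoid R by unfold_locales fact
  interpret S: tame_com_monoid S by unfold_locales fact
  have h_fun: "h \<in> mcarrier (base R) \<rightarrow>\<^sub>E mcarrier (base S)"
    and h_act: "\<And>f x. inj f \<Longrightarrow> x \<in> mcarrier (base R) \<Longrightarrow> h (mact (base R) f x) = mact (base S) f (h x)"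
    using h by (simp_all add: com_monoid_hom_def M_hom_def)
  have "h (aact (op_set_of R) n \<phi> x) = aact (op_set_of S) n \<phi> (\<lambda>i\<in>{1..n}. h (x i))"
    if \<phi>: "\<phi> \<in> inj_op n" and x: "x \<in> tuples (op_set_of R) n" for n \<phi> x
  proof -
    have mem: "x i \<in> mcarrier (base R)" if "i \<in> {1..n}" for i
      using PiE_mem [OF x [unfolded tuples_def] that] by simp
    have x': "(\<lambda>i\<in>{1..n}. h (x i)) \<in> tuples (op_set_of S) n"
      unfolding tuples_def using mem PiE_mem [OF h_fun] by simp
    have "h (aact (op_set_of R) n \<phi> x) = monoid_sum S {1..n} (\<lambda>i. h (mact (base R) (\<lambda>j. \<phi> (i, j)) (x i)))"
      unfolding aact_op_set_of [OF \<phi> x]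
      by (rule hom_monoid_sum [OF R S h _ R.independent_slots [OF \<phi> mem]]) simp
    also have "\<dots> = monoid_sum S {1..n} (\<lambda>i. mact (base S) (\<lambda>j. \<phi> (i, j)) ((\<lambda>i\<in>{1..n}. h (x i)) i))"
      by (rule monoid_sum_cong) (use h_act inj_op_slot [OF \<phi>] mem in simp)
    also have "\<dots> = aact (op_set_of S) n \<phi> (\<lambda>i\<in>{1..n}. h (x i))"
      by (rule aact_op_set_of [symmetric, OF \<phi> x'])
    finally show ?thesis .
  qed
  then show ?thesis using h_fun by (simp add: op_set_hom_def)
qed


section \<open>The isomorphism of categories\<close>

lemma op_set_hom_compose:
  assumes "f \<in> op_set_hom X Y" "g \<in> op_set_hom Y Z" and X: "is_tame_op_set X"
  shows "compose (acarrier X) g f \<in> op_set_hom X Z"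
proof -
  interpret X: tame_op_set X by unfold_locales fact
  have f_fun: "f \<in> acarrier X \<rightarrow>\<^sub>E acarrier Y" and g_fun: "g \<in> acarrier Y \<rightarrow>\<^sub>E acarrier Z"
    using assms by (simp_all add: op_set_hom_def)
  have "compose (acarrier X) g f (aact X n \<phi> x) = aact Z n \<phi> (\<lambda>i\<in>{1..n}. compose (acarrier X) g f (x i))"
    if \<phi>: "\<phi> \<in> inj_op n" and x: "x \<in> tuples X n" for n \<phi> x
  proof -
    have mem: "x i \<in> acarrier X" if "i \<in> {1..n}" for i using X.tuples_mem [OF x that] .
    have "compose (acarrier X) g f (aact X n \<phi> x) = g (f (aact X n \<phi> x))"
      using X.op_act_closed [OF \<phi> x] by (simp add: compose_eq)
    also have "\<dots> = g (aact Y n \<phi> (\<lambda>i\<in>{1..n}. f (x i)))"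
      using assms(1) \<phi> x by (simp add: op_set_hom_def)
    also have "\<dots> = aact Z n \<phi> (\<lambda>i\<in>{1..n}. g ((\<lambda>i\<in>{1..n}. f (x i)) i))"
    proof -
      have "(\<lambda>i\<in>{1..n}. f (x i)) \<in> tuples Y n"
        unfolding tuples_def using mem PiE_mem [OF f_fun] by simp
      then show ?thesis using assms(2) \<phi> unfolding op_set_hom_def by blast
    qed
    also have "(\<lambda>i\<in>{1..n}. g ((\<lambda>i\<in>{1..n}. f (x i)) i)) = (\<lambda>i\<in>{1..n}. compose (acarrier X) g f (x i))"
      by (rule restrict_ext) (simp add: compose_eq mem)
    finally show ?thesis .
  qed
  moreover have "compose (acarrier X) g f \<in> acarrier X \<rightarrow>\<^sub>E acarrier Z"
    using f_fun g_fun by (auto simp: compose_def)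
  ultimately show ?thesis by (simp add: op_set_hom_def)
qed

lemma compose_restrict_id:
  assumes "f \<in> A \<rightarrow>\<^sub>E B"
  shows "compose A f (\<lambda>x\<in>A. x) = f" "compose A (\<lambda>x\<in>B. x) f = f"
  using assms PiE_mem [OF assms] by (auto simp: compose_def PiE_def intro!: extensionalityI [where A = A])

lemma is_category_tame_op_set_cat: "is_category tame_op_set_cat"
  unfolding is_category_def tame_op_set_cat_def cat.simps
proof (intro conjI ballI)
  fix X :: "'a op_set" assume "X \<in> {X. is_tame_op_set X}"
  then interpret X: tame_op_set X by unfold_locales simp
  have "(\<lambda>x\<in>acarrier X. x) (aact X n \<phi> x) = aact X n \<phi> (\<lambda>i\<in>{1..n}. (\<lambda>x\<in>acarrier X. x) (x i))"
    if "\<phi> \<in> inj_op n" "x \<in> tuples X n" for n \<phi> x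
  proof -
    have "(\<lambda>i\<in>{1..n}. (\<lambda>x\<in>acarrier X. x) (x i)) = x"
      using X.tuples_mem [OF that(2)] that(2)
      by (intro extensionalityI [where A = "{1..n}"]) (auto simp: tuples_def PiE_def)
    then show ?thesis using X.op_act_closed [OF that] by simp
  qed
  then show "(\<lambda>x\<in>acarrier X. x) \<in> op_set_hom X X"
    unfolding op_set_hom_def by (intro CollectI conjI allI ballI) auto
next
  fix X Y Z :: "'a op_set" and f g
  assume "X \<in> {X. is_tame_op_set X}" "f \<in> op_set_hom X Y" "g \<in> op_set_hom Y Z"
  then show "compose (acarrier X) g f \<in> op_set_hom X Z"
    by (intro op_set_hom_compose) simp_all
next
  fix X Y :: "'a op_set" and f assume "f \<in> op_set_hom X Y"
  then have "f \<in> acarrier X \<rightarrow>\<^sub>E acarrier Y" by (simp add: op_set_hom_def)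
  then show "compose (acarrier X) f (\<lambda>x\<in>acarrier X. x) = f" "compose (acarrier X) (\<lambda>x\<in>acarrier Y. x) f = f"
    by (rule compose_restrict_id)+
next
  fix W X Y Z :: "'a op_set" and f g h
  assume "f \<in> op_set_hom W X"
  then have "f \<in> acarrier W \<rightarrow> acarrier X" by (simp add: op_set_hom_def PiE_def)
  then show "compose (acarrier W) h (compose (acarrier W) g f) = compose (acarrier W) (compose (acarrier X) h g) f"
    by (rule compose_assoc)
qed

text \<open>The two kinds of morphism are the same sets of functions. Closure under identities and
  composition thus passes from algebras to monoids.\<close>

lemma com_monoid_hom_iff:
  assumes "is_tame_com_monoid R" "is_tame_com_monoid S"
  shows "h \<in> com_monoid_hom R S \<longleftrightarrow> h \<in> op_set_hom (op_set_of R) (op_set_of S)"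
proof -
  interpret R: tame_com_monoid R by unfold_locales fact
  interpret S: tame_com_monoid S by unfold_locales fact
  show ?thesis
    using op_set_hom_imp_com_monoid_hom [OF R.is_tame_op_set_of S.is_tame_op_set_of, of h]
      com_monoid_hom_imp_op_set_hom [OF assms, of h]
    unfolding R.sum_monoid_op_set_of S.sum_monoid_op_set_of by blast
qed

lemma is_category_com_monoid_cat: "is_category com_monoid_cat"
proof -
  note op = is_category_tame_op_set_cat [unfolded is_category_def tame_op_set_cat_def cat.simps]
  have ob: "op_set_of R \<in> {X. is_tame_op_set X}" if "R \<in> {R. is_tame_com_monoid R}" for R :: "'a M_monoid"
    using tame_com_monoid.is_tame_op_set_of [of R] that by (simp add: tame_com_monoid_def)
  show ?thesis
    unfolding is_category_def com_monoid_cat_def cat.simps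
  proof (intro conjI ballI)
    fix R :: "'a M_monoid" assume R: "R \<in> {R. is_tame_com_monoid R}"
    show "(\<lambda>x\<in>mcarrier (base R). x) \<in> com_monoid_hom R R"
      using op [THEN conjunct1, rule_format, OF ob [OF R]] R by (simp add: com_monoid_hom_iff)
  next
    fix R S T :: "'a M_monoid" and f g
    assume "R \<in> {R. is_tame_com_monoid R}" "S \<in> {R. is_tame_com_monoid R}" "T \<in> {R. is_tame_com_monoid R}"
      and "f \<in> com_monoid_hom R S" "g \<in> com_monoid_hom S T"
    then show "compose (mcarrier (base R)) g f \<in> com_monoid_hom R T"
      using op [THEN conjunct2, THEN conjunct1, rule_format, OF ob ob ob, of R S T f g]
      by (simp add: com_monoid_hom_iff)
  next
    fix R S :: "'a M_monoid" and f assume "f \<in> com_monoid_hom R S"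
    then have "f \<in> mcarrier (base R) \<rightarrow>\<^sub>E mcarrier (base S)" by (simp add: com_monoid_hom_def M_hom_def)
    then show "compose (mcarrier (base R)) f (\<lambda>x\<in>mcarrier (base R). x) = f"
      "compose (mcarrier (base R)) (\<lambda>x\<in>mcarrier (base S). x) f = f"
      by (rule compose_restrict_id)+
  next
    fix Q R S T :: "'a M_monoid" and f g h
    assume "f \<in> com_monoid_hom Q R"
    then have "f \<in> mcarrier (base Q) \<rightarrow> mcarrier (base R)" by (simp add: com_monoid_hom_def M_hom_def PiE_def)
    then show "compose (mcarrier (base Q)) h (compose (mcarrier (base Q)) g f) =
        compose (mcarrier (base Q)) (compose (mcarrier (base R)) h g) f"
      by (rule compose_assoc)
  qed
qed

lemma acarrier_eq: "mcarrier (base (sum_monoid X)) = acarrier X"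
  by (simp add: sum_monoid_def underlying_def)

theorem theoremA13:
  "is_category_isomorphism
     (tame_op_set_cat :: ('a op_set, 'a \<Rightarrow> 'a) cat)
     (com_monoid_cat :: ('a M_monoid, 'a \<Rightarrow> 'a) cat)
     sum_functor"
proof -
  let ?C = "tame_op_set_cat :: ('a op_set, 'a \<Rightarrow> 'a) cat"
  let ?D = "com_monoid_cat :: ('a M_monoid, 'a \<Rightarrow> 'a) cat"
  \<comment> \<open>The inverse likewise leaves maps unchanged, so on morphisms functoriality
    reduces to the inclusions between the two kinds of morphism sets.\<close>
  let ?G = "\<lparr>fobj = op_set_of, fmor = (\<lambda>R S h. h)\<rparr> :: ('a M_monoid, 'a \<Rightarrow> 'a, 'a op_set, 'a \<Rightarrow> 'a) funct"
  have op: "is_tame_com_monoid (sum_monoid X)" "op_set_of (sum_monoid X) = X" if "is_tame_op_set X" for X :: "'a op_set"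
    using tame_op_set.tame_com_monoid_sum_monoid [of X] tame_op_set.op_set_of_sum_monoid [of X] that
    by (simp_all add: tame_op_set_def)
  have com: "is_tame_op_set (op_set_of R)" "sum_monoid (op_set_of R) = R" if "is_tame_com_monoid R" for R :: "'a M_monoid"
    using tame_com_monoid.is_tame_op_set_of [of R] tame_com_monoid.sum_monoid_op_set_of [of R] that
    by (simp_all add: tame_com_monoid_def)
  have "is_functor ?C ?D sum_functor"
    using op
    by (simp add: op_set_hom_imp_com_monoid_hom is_functor_def tame_op_set_cat_def com_monoid_cat_def sum_functor_def acarrier_eq)
  moreover have "is_functor ?D ?C ?G"
    using com
    by (simp add: com_monoid_hom_imp_op_set_hom is_functor_def tame_op_set_cat_def com_monoid_cat_def)
  moreover have "inverse_functor ?C sum_functor ?G" "inverse_functor ?D ?G sum_functor"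
    using op com by (simp_all add: inverse_functor_def tame_op_set_cat_def com_monoid_cat_def sum_functor_def)
  ultimately show ?thesis
    unfolding is_category_isomorphism_def
    using is_category_tame_op_set_cat is_category_com_monoid_cat by blast
qed

end
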